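(* Consider $n$ jobs on a single machine with weights $w_j\ge0$, release dates $r_j\ge0$, independent non-negative random processing times $\bm p_j$ with $\bar p_j=\mathrm E[\bm p_j]>0$ and $\mathrm{CV}[\bm p_j]^2\le\Delta$ for all $j$, indexed so that $w_1/\bar p_1\ge\cdots\ge w_n/\bar p_n$. Let $\alpha\in(0,1]$ be arbitrary and $c:=1+\max\bigl\{\frac1\alpha,\ 1+\alpha-g(\Delta)(1-\alpha)\bigr\}$. Then the $\mathrm{SOS}(\alpha)$ policy satisfies \[\mathrm E\Bigl[\sum_{j=1}^nw_j\bm M_j^{\mathrm{SOS}(\alpha)}\Bigr]\le c\sum_{j=1}^nw_jM_j^{\mathrm{S^p}}\le c\,\mathrm E\Bigl[\sum_{j=1}^nw_j\bm M_j^{\mathrm{OPT}}\Bigr],\] where $\mathrm{OPT}$ is an optimal (non-preemptive, non-anticipative) scheduling policy.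
   Context: $\mathrm{CV}[\bm p]^2:=\mathrm{Var}[\bm p]/\mathrm E[\bm p]^2$; $g(\Delta):=(2-\sqrt\Delta)/2$ for $\Delta\le1$, $g(\Delta):=1/(\Delta+1)$ for $\Delta\ge1$. Policies are non-preemptive, never start $j$ before $r_j$, and are non-anticipative. $\mathrm{S^p}$ is the preemptive WSPT schedule of the deterministic counterparts (processing times $\bar p_j$): at each time the released unfinished job of smallest index is processed; $I_j^{\mathrm{S^p}}(t)\in\{0,1\}$ indicates processing of $j$ at $t$; $M_j^{\mathrm{S^p}}:=\frac1{\bar p_j}\int_0^\infty I_j^{\mathrm{S^p}}(t)t\,\mathrm dt$; for a non-preemptive policy $\Pi$, $\bm M_j^\Pi:=\bm C_j^\Pi-\bm p_j/2$. The $\alpha$-point is $C_j(\alpha):=\min\{t\ge0:\int_0^tI_j^{\mathrm{S^p}}(s)\mathrm ds\ge\alpha\bar p_j\}$. $\mathrm{SOS}(\alpha)$ schedules each job $j$ non-preemptively as early as possible after $C_j(\alpha)$ and after all jobs $k$ with $C_k(\alpha)<C_j(\alpha)$. *)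

theory Defs
  imports "HOL-Probability.Probability"
begin

text \<open>Jobs are \<open>1, \<dots>, n\<close>. A realisation of the processing times is a function \<open>x\<close> on jobs.\<close>

definition CV2 :: "'a measure \<Rightarrow> ('a \<Rightarrow> real) \<Rightarrow> real" where
  "CV2 M X = prob_space.variance M X / (prob_space.expectation M X)\<^sup>2"

definition g :: "real \<Rightarrow> real" where
  "g \<Delta> = (if \<Delta> \<le> 1 then (2 - sqrt \<Delta>) / 2 else 1 / (\<Delta> + 1))"

subsection \<open>The preemptive WSPT schedule of the deterministic counterparts\<close>

text \<open>\<open>q j\<close> is the deterministic processing time of \<open>j\<close>, and \<open>I j t \<in> {0, 1}\<close> indicates
  whether \<open>j\<close> is processed at time \<open>t\<close>.\<close>

definition processed :: "(nat \<Rightarrow> real \<Rightarrow> real) \<Rightarrow> nat \<Rightarrow> real \<Rightarrow> real" where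
  "processed I j t = (LINT s:{0..t}|lborel. I j s)"

definition available ::
  "(nat \<Rightarrow> real) \<Rightarrow> (nat \<Rightarrow> real) \<Rightarrow> (nat \<Rightarrow> real \<Rightarrow> real) \<Rightarrow> nat \<Rightarrow> real \<Rightarrow> bool" where
  "available r q I j t \<longleftrightarrow> r j \<le> t \<and> processed I j t < q j"

text \<open>The rule refers to the work done so far, so it constrains \<open>I\<close> implicitly; existence of
  such an \<open>I\<close> is proved below as \<open>preemptive_WSPT_exists\<close>.\<close>

definition preemptive_WSPT ::
  "nat \<Rightarrow> (nat \<Rightarrow> real) \<Rightarrow> (nat \<Rightarrow> real) \<Rightarrow> (nat \<Rightarrow> real \<Rightarrow> real) \<Rightarrow> bool" where
  "preemptive_WSPT n r q I \<longleftrightarrow>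
     (\<forall>j\<in>{1..n}. set_borel_measurable lborel {0..} (I j)) \<and>
     (\<forall>j\<in>{1..n}. \<forall>t\<ge>0. I j t =
        (if available r q I j t \<and> (\<forall>k\<in>{1..<j}. \<not> available r q I k t) then 1 else 0))"

function WSPT_set :: "(nat \<Rightarrow> real) \<Rightarrow> (nat \<Rightarrow> real) \<Rightarrow> nat \<Rightarrow> real set" where
  "WSPT_set r q j =
     {t. r j \<le> t \<and> (\<forall>k\<in>{1..<j}. t \<notin> WSPT_set r q k) \<and>
         measure lborel ({r j..t} - (\<Union>k\<in>{1..<j}. WSPT_set r q k)) < q j}"
  by auto
termination by (relation "Wellfounded.measure (\<lambda>(r, q, j). j)") auto

declare WSPT_set.simps [simp del]

lemma WSPT_set_aux:
  fixes F :: "real set" and a q :: real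
  defines "f \<equiv> \<lambda>t. measure lborel ({a..t} - F)"
  assumes F: "F \<in> sets borel" and a: "0 \<le> a" and q: "0 < q"
  defines "A \<equiv> {t. a \<le> t \<and> t \<notin> F \<and> f t < q}"
  shows "A \<in> sets borel"
    and "a \<le> t \<Longrightarrow> measure lborel (A \<inter> {0..t}) < q \<longleftrightarrow> f t < q"
proof -
  have fm: "{a..t} - F \<in> fmeasurable lborel" for t
    using F by (intro fmeasurable_Diff) (auto simp: fmeasurable_def emeasure_lborel_Icc_eq)
  have mono: "f s \<le> f t" if "s \<le> t" for s t
    unfolding f_def using that F by (intro measure_mono_fmeasurable fm) auto
  have lip: "f t \<le> f s + (t - s)" if "s \<le> t" for s t
  proof -
    have "f t \<le> measure lborel (({a..s} - F) \<union> {s..t})"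
      unfolding f_def using F by (intro measure_mono_fmeasurable fmeasurable.Un fm)
        (auto simp: fmeasurable_def emeasure_lborel_Icc_eq)
    also have "\<dots> \<le> measure lborel ({a..s} - F) + measure lborel {s..t}"
      using F by (intro measure_Un_le) auto
    finally show ?thesis using that by (simp add: f_def)
  qed
  have cont: "continuous_on S f" for S
  proof (rule continuous_onI)
    fix x e :: real assume "0 < e"
    have "dist (f y) (f x) \<le> e" if "dist y x < e" for y
      using that lip[of x y] lip[of y x] mono[of x y] mono[of y x]
      by (cases "x \<le> y") (auto simp: dist_real_def)
    then show "\<exists>d>0. \<forall>y\<in>S. dist y x < d \<longrightarrow> dist (f y) (f x) \<le> e"
      using \<open>0 < e\<close> by blast
  qed
  have [measurable]: "f \<in> borel_measurable borel"
    using cont[of UNIV] by (rule borel_measurable_continuous_onI)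
  note [measurable] = F
  show A: "A \<in> sets borel"
    unfolding A_def by measurable
  have fmA: "A \<inter> {0..t} \<in> fmeasurable lborel" for t
    by (rule fmeasurableI2[of "{0..t}"])
      (use A in \<open>auto simp: fmeasurable_def emeasure_lborel_Icc_eq\<close>)
  assume t: "a \<le> t"
  show "measure lborel (A \<inter> {0..t}) < q \<longleftrightarrow> f t < q"
  proof
    assume "f t < q"
    then have "f s < q" if "s \<le> t" for s
      using mono[OF that] by simp
    then have "A \<inter> {0..t} = {a..t} - F"
      using a by (auto simp: A_def)
    then show "measure lborel (A \<inter> {0..t}) < q"
      using \<open>f t < q\<close> by (simp add: f_def)
  next
    assume less: "measure lborel (A \<inter> {0..t}) < q"
    show "f t < q"
    proof (rule ccontr)
      assume "\<not> f t < q"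
      define v where "v = (measure lborel (A \<inter> {0..t}) + q) / 2"
      have v: "0 \<le> v" "v < q" "measure lborel (A \<inter> {0..t}) < v"
        using less q by (auto simp: v_def add_nonneg_nonneg field_simps)
      have "f a \<le> 0"
        using measure_mono_fmeasurable[of "{a..a} - F" "{a..a}" lborel] F
        by (auto simp: f_def fmeasurable_def emeasure_lborel_Icc_eq)
      then obtain u where u: "a \<le> u" "u \<le> t" "f u = v"
        using IVT'[of f a v t] v t \<open>\<not> f t < q\<close> cont by auto
      have "{a..u} - F \<subseteq> A \<inter> {0..t}"
      proof
        fix s assume s: "s \<in> {a..u} - F"
        then have "f s \<le> f u" by (intro mono) auto
        then show "s \<in> A \<inter> {0..t}" using s u v a by (auto simp: A_def)
      qed
      then have "v \<le> measure lborel (A \<inter> {0..t})"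
        unfolding u(3)[symmetric] f_def using F
        by (intro measure_mono_fmeasurable fmA) auto
      then show False using v by simp
    qed
  qed
qed

lemma preemptive_WSPT_exists:
  assumes r: "\<And>j. j \<in> {1..n} \<Longrightarrow> 0 \<le> r j" and q: "\<And>j. j \<in> {1..n} \<Longrightarrow> 0 < q j"
  shows "\<exists>I. preemptive_WSPT n r q I"
proof -
  define A where "A = WSPT_set r q"
  define F where "F j = (\<Union>k\<in>{1..<j}. A k)" for j
  define I where "I j t = (indicator (A j) t :: real)" for j t
  have A_eq: "A j = {t. r j \<le> t \<and> t \<notin> F j \<and> measure lborel ({r j..t} - F j) < q j}" for j
    unfolding A_def F_def by (subst WSPT_set.simps) auto
  have borel: "A j \<in> sets borel" if "j \<in> {1..n}" for j
    using that
  proof (induction j rule: less_induct)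
    case (less j)
    have "F j \<in> sets borel"
      unfolding F_def using less by (intro sets.finite_UN) auto
    from WSPT_set_aux(1)[OF this r[OF less.prems] q[OF less.prems]] show ?case
      by (simp add: A_eq[of j])
  qed
  have processed: "processed I j t = measure lborel (A j \<inter> {0..t})" if "j \<in> {1..n}" for j t
  proof -
    have "A j \<inter> {0..t} \<in> sets lborel" using borel[OF that] by auto
    moreover have "processed I j t = integral\<^sup>L lborel (indicator (A j \<inter> {0..t}))"
      unfolding processed_def set_lebesgue_integral_def I_def
      by (intro Bochner_Integration.integral_cong) (auto simp: indicator_def)
    ultimately show ?thesis by simp
  qed
  have avail: "available r q I j t \<longleftrightarrow> r j \<le> t \<and> measure lborel ({r j..t} - F j) < q j"
    if j: "j \<in> {1..n}" for j t
  proof -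
    have "F j \<in> sets borel"
      unfolding F_def using borel j by (intro sets.finite_UN) auto
    from WSPT_set_aux(2)[OF this r[OF j] q[OF j], of t] show ?thesis
      unfolding available_def processed[OF j] A_eq[of j] by auto
  qed
  have mem: "t \<in> A j \<longleftrightarrow> available r q I j t \<and> (\<forall>k\<in>{1..<j}. \<not> available r q I k t)"
    if "j \<in> {1..n}" for j t
    using that
  proof (induction j rule: less_induct)
    case (less j)
    have A_iff: "t \<in> A j \<longleftrightarrow> available r q I j t \<and> (\<forall>k\<in>{1..<j}. t \<notin> A k)"
      using avail[OF less.prems] by (subst A_eq) (auto simp: F_def)
    have "\<exists>k\<in>{1..<j}. t \<in> A k" if "k \<in> {1..<j}" "available r q I k t" for k
    proof -
      define m where "m = (LEAST k. k \<in> {1..<j} \<and> available r q I k t)"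
      have m: "m \<in> {1..<j}" "available r q I m t"
        using LeastI[of "\<lambda>k. k \<in> {1..<j} \<and> available r q I k t" k] that
        unfolding m_def by auto
      have "\<not> available r q I i t" if "i \<in> {1..<m}" for i
        using not_less_Least[of i "\<lambda>k. k \<in> {1..<j} \<and> available r q I k t"] that m(1)
        unfolding m_def[symmetric] by auto
      then show ?thesis using less.IH[of m] m less.prems by auto
    qed
    moreover have "available r q I k t" if "k \<in> {1..<j}" "t \<in> A k" for k
      using less.IH[of k] that less.prems by auto
    ultimately show ?case using A_iff by blast
  qed
  have "preemptive_WSPT n r q I"
    unfolding preemptive_WSPT_def
  proof (intro conjI ballI allI impI)
    fix j assume "j \<in> {1..n}"
    note [measurable] = borel[OF this]
    show "set_borel_measurable lborel {0..} (I j)"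
      unfolding set_borel_measurable_def I_def by measurable
  next
    fix j and t :: real assume "j \<in> {1..n}"
    show "I j t =
        (if available r q I j t \<and> (\<forall>k\<in>{1..<j}. \<not> available r q I k t) then 1 else 0)"
      unfolding mem[OF \<open>j \<in> {1..n}\<close>, symmetric] by (simp add: I_def)
  qed
  then show ?thesis by blast
qed

definition preemptive_mean_busy_date ::
  "(nat \<Rightarrow> real) \<Rightarrow> (nat \<Rightarrow> real \<Rightarrow> real) \<Rightarrow> nat \<Rightarrow> real" where
  "preemptive_mean_busy_date q I j = 1 / q j * (LINT t:{0..}|lborel. I j t * t)"

definition alpha_point ::
  "(nat \<Rightarrow> real) \<Rightarrow> (nat \<Rightarrow> real \<Rightarrow> real) \<Rightarrow> real \<Rightarrow> nat \<Rightarrow> real" where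
  "alpha_point q I \<alpha> j = (LEAST t. 0 \<le> t \<and> processed I j t \<ge> \<alpha> * q j)"

subsection \<open>Non-preemptive, non-anticipative policies\<close>

text \<open>A policy maps each realisation \<open>x\<close> to the start times of the jobs.\<close>

type_synonym policy = "(nat \<Rightarrow> real) \<Rightarrow> nat \<Rightarrow> real"

definition completion_time :: "policy \<Rightarrow> (nat \<Rightarrow> real) \<Rightarrow> nat \<Rightarrow> real" where
  "completion_time \<pi> x j = \<pi> x j + x j"

definition mean_busy_date :: "policy \<Rightarrow> (nat \<Rightarrow> real) \<Rightarrow> nat \<Rightarrow> real" where
  "mean_busy_date \<pi> x j = completion_time \<pi> x j - x j / 2"

text \<open>On one machine without preemption, information is revealed only while a job is running,
  and by the next start that job is complete. Hence a non-anticipative policy is given by a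
  rule that maps the observations made so far, namely triples of job, start time and realised
  processing time of the completed jobs, to the next job and its start time. Deciding job by
  job rather than instant by instant also accounts for jobs of realised length zero, after
  which a further job may start at the same instant.\<close>

type_synonym decision_rule = "(nat \<times> real \<times> real) list \<Rightarrow> nat \<times> real"

primrec history ::
  "decision_rule \<Rightarrow> (nat \<Rightarrow> real) \<Rightarrow> nat \<Rightarrow> (nat \<times> real \<times> real) list" where
  "history d x 0 = []"
| "history d x (Suc i) =
     history d x i @ [(let (j, s) = d (history d x i) in (j, s, x j))]"

definition next_job :: "decision_rule \<Rightarrow> (nat \<Rightarrow> real) \<Rightarrow> nat \<Rightarrow> nat" where
  "next_job d x i = fst (d (history d x i))"

definition next_start :: "decision_rule \<Rightarrow> (nat \<Rightarrow> real) \<Rightarrow> nat \<Rightarrow> real" where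
  "next_start d x i = snd (d (history d x i))"

definition scheduling_policy :: "nat \<Rightarrow> (nat \<Rightarrow> real) \<Rightarrow> policy \<Rightarrow> bool" where
  "scheduling_policy n r \<pi> \<longleftrightarrow>
     (\<forall>j\<in>{1..n}. (\<lambda>x. \<pi> x j) \<in> borel_measurable (\<Pi>\<^sub>M i\<in>{1..n}. restrict_space borel {0..})) \<and>
     (\<exists>d. \<forall>x \<in> {1..n} \<rightarrow>\<^sub>E {0..}.
        bij_betw (next_job d x) {..<n} {1..n} \<and>
        (\<forall>i<n. \<pi> x (next_job d x i) = next_start d x i \<and>
               r (next_job d x i) \<le> next_start d x i \<and>
               (\<forall>l<i. completion_time \<pi> x (next_job d x l) \<le> next_start d x i)))"

definition realisation :: "nat \<Rightarrow> (nat \<Rightarrow> 'a \<Rightarrow> real) \<Rightarrow> 'a \<Rightarrow> nat \<Rightarrow> real" where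
  "realisation n p \<omega> = (\<lambda>j\<in>{1..n}. p j \<omega>)"

text \<open>Expectations of the non-negative objectives are taken in \<open>ennreal\<close>, so that an infinite
  expectation is not mistaken for zero.\<close>

definition expected_weighted_completion ::
  "'a measure \<Rightarrow> nat \<Rightarrow> (nat \<Rightarrow> real) \<Rightarrow> (nat \<Rightarrow> 'a \<Rightarrow> real) \<Rightarrow> policy \<Rightarrow> ennreal" where
  "expected_weighted_completion M n w p \<pi> =
     (\<integral>\<^sup>+\<omega>. ennreal (\<Sum>j=1..n. w j * completion_time \<pi> (realisation n p \<omega>) j) \<partial>M)"

definition expected_weighted_mean_busy ::
  "'a measure \<Rightarrow> nat \<Rightarrow> (nat \<Rightarrow> real) \<Rightarrow> (nat \<Rightarrow> 'a \<Rightarrow> real) \<Rightarrow> policy \<Rightarrow> ennreal" where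
  "expected_weighted_mean_busy M n w p \<pi> =
     (\<integral>\<^sup>+\<omega>. ennreal (\<Sum>j=1..n. w j * mean_busy_date \<pi> (realisation n p \<omega>) j) \<partial>M)"

definition optimal_policy ::
  "'a measure \<Rightarrow> nat \<Rightarrow> (nat \<Rightarrow> real) \<Rightarrow> (nat \<Rightarrow> real) \<Rightarrow> (nat \<Rightarrow> 'a \<Rightarrow> real) \<Rightarrow> policy \<Rightarrow> bool" where
  "optimal_policy M n w r p \<pi> \<longleftrightarrow> scheduling_policy n r \<pi> \<and>
     (\<forall>\<pi>'. scheduling_policy n r \<pi>' \<longrightarrow>
        expected_weighted_completion M n w p \<pi> \<le> expected_weighted_completion M n w p \<pi>')"

subsection \<open>The SOS policy\<close>

text \<open>\<open>C\<close> stands for the \<open>\<alpha>\<close>-points: each job starts as early as possible after its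
  \<open>\<alpha>\<close>-point and the completion of all jobs with smaller \<open>\<alpha>\<close>-point.\<close>

function list_start :: "nat \<Rightarrow> (nat \<Rightarrow> real) \<Rightarrow> policy" where
  "list_start n C x j =
     Max (insert (C j) ((\<lambda>k. list_start n C x k + x k) ` {k\<in>{1..n}. C k < C j}))"
  by auto
termination
proof (relation "Wellfounded.measure (\<lambda>(n, C, x, j). card {k\<in>{1..n}. C k < C j})", goal_cases)
  case 1
  show ?case by simp
next
  case (2 n C x j k)
  have "{i\<in>{1..n}. C i < C k} \<subset> {i\<in>{1..n}. C i < C j}"
    using 2 by fastforce
  then show ?case by (simp add: psubset_card_mono)
qed

declare list_start.simps [simp del]

definition SOS :: "nat \<Rightarrow> (nat \<Rightarrow> real) \<Rightarrow> (nat \<Rightarrow> real \<Rightarrow> real) \<Rightarrow> real \<Rightarrow> policy" where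
  "SOS n q I \<alpha> = list_start n (alpha_point q I \<alpha>)"

end

theory Submission
  imports Defs
begin

text \<open>
  Since \<open>w j / q j\<close> is non-increasing, \<open>\<Sum>j. w j * a j\<close> is a non-negative combination of the prefix
  sums \<open>\<Sum>j\<le>k. q j * a j\<close>, so it suffices to compare mean busy dates weighted by \<open>q\<close> for each
  prefix. The preemptive schedule of the jobs \<open>1, \<dots>, k\<close> ignores all later jobs and splits into
  maximal busy intervals \<open>[b, b + P]\<close>; the jobs of such a block contribute exactly \<open>b P + P\<^sup>2 / 2\<close>.

  For \<open>SOS\<close>, a job with smaller \<open>\<alpha>\<close>-point than a job \<open>j\<close> of the block either lies in the block or
  has \<open>\<alpha>\<close>-point at most \<open>b\<close>, and the jobs of the latter kind have total expected length at most
  \<open>b / \<alpha>\<close>. Since the machine works on the block throughout \<open>[b, C j]\<close>, the \<open>\<alpha>\<close>-point \<open>C j\<close> is at most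
  \<open>b + \<alpha> P\<close> plus \<open>(1 - \<alpha>) q i\<close> for each earlier job \<open>i\<close> of the block. Inductively each such \<open>i\<close>
  delays \<open>j\<close> by at most \<open>max (p i) ((1 - \<alpha>) q i)\<close>, whose expectation is at most
  \<open>(1 + (1 - \<alpha>) (1 - g \<Delta>)) q i\<close>.

  For an arbitrary policy, all jobs of the block are released after \<open>b\<close>, hence
  \<open>\<Sum>j. p j * s j \<ge> b * (\<Sum>j. p j) + (\<Sum>i<j. p i * p j)\<close> holds for its start times \<open>s j\<close> in every
  realisation. Taking expectations and using that \<open>s j\<close> does not depend on \<open>p j\<close> gives the lower
  bound \<open>b P + P\<^sup>2 / 2\<close> for the block.
\<close>

section \<open>Sums over ordered index sets\<close>

text \<open>Expanding the square, the pairs with \<open>f i < f j\<close> and those with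
  \<open>f j < f i\<close> contribute equally by symmetry; ties, including the diagonal, keep a sum
  of their own.\<close>

lemma square_sum_by_order:
  fixes x :: "'i \<Rightarrow> real" and f :: "'i \<Rightarrow> 'b :: linorder"
  assumes "finite S"
  shows "(\<Sum>j\<in>S. x j)\<^sup>2 = 2 * (\<Sum>j\<in>S. x j * (\<Sum>i\<in>{i\<in>S. f i < f j}. x i))
      + (\<Sum>j\<in>S. x j * (\<Sum>i\<in>{i\<in>S. f i = f j}. x i))"
proof -
  let ?lt = "\<lambda>i j. if f i < f j then x j * x i else 0"
  let ?eq = "\<lambda>i j. if f i = f j then x j * x i else 0"
  have "(\<Sum>j\<in>S. x j)\<^sup>2 = (\<Sum>j\<in>S. \<Sum>i\<in>S. ?lt i j + ?lt j i + ?eq i j)"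
    unfolding power2_eq_square sum_product by (intro sum.cong) auto
  also have "\<dots> = (\<Sum>j\<in>S. \<Sum>i\<in>S. ?lt i j) + (\<Sum>j\<in>S. \<Sum>i\<in>S. ?lt j i)
      + (\<Sum>j\<in>S. \<Sum>i\<in>S. ?eq i j)"
    by (simp add: sum.distrib)
  also have "(\<Sum>j\<in>S. \<Sum>i\<in>S. ?lt j i) = (\<Sum>j\<in>S. \<Sum>i\<in>S. ?lt i j)"
    by (rule sum.swap)
  finally show ?thesis
    using assms by (simp add: sum.inter_filter sum_distrib_left if_distrib cong: if_cong)
qed

text \<open>The tie class of \<open>j\<close> contains \<open>j\<close>, so for non-negative
  \<open>x\<close> it can be cut down to the diagonal. This serves the order by \<alpha>-points,
  where ties are not excluded.\<close>

lemma square_sum_by_order_ge: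
  fixes x :: "'i \<Rightarrow> real" and f :: "'i \<Rightarrow> 'b :: linorder"
  assumes "finite S" "\<And>j. j \<in> S \<Longrightarrow> 0 \<le> x j"
  shows "2 * (\<Sum>j\<in>S. x j * (\<Sum>i\<in>{i\<in>S. f i < f j}. x i)) + (\<Sum>j\<in>S. (x j)\<^sup>2) \<le> (\<Sum>j\<in>S. x j)\<^sup>2"
proof -
  have "(x j)\<^sup>2 \<le> x j * (\<Sum>i\<in>{i\<in>S. f i = f j}. x i)" if "j \<in> S" for j
    unfolding power2_eq_square using assms that
    by (intro mult_left_mono member_le_sum) auto
  then have "(\<Sum>j\<in>S. (x j)\<^sup>2) \<le> (\<Sum>j\<in>S. x j * (\<Sum>i\<in>{i\<in>S. f i = f j}. x i))"
    by (rule sum_mono)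
  then show ?thesis using square_sum_by_order[OF assms(1), of x f] by simp
qed

text \<open>Only the first sum mentions \<open>f\<close>, so it is the same for every injective
  ranking; the order chosen by a policy can thus be traded for the index order.\<close>

lemma square_sum_by_order_inj:
  fixes x :: "'i \<Rightarrow> real" and f :: "'i \<Rightarrow> 'b :: linorder"
  assumes "finite S" "inj_on f S"
  shows "2 * (\<Sum>j\<in>S. x j * (\<Sum>i\<in>{i\<in>S. f i < f j}. x i)) + (\<Sum>j\<in>S. (x j)\<^sup>2) = (\<Sum>j\<in>S. x j)\<^sup>2"
proof -
  have "x j * (\<Sum>i\<in>{i\<in>S. f i = f j}. x i) = (x j)\<^sup>2" if "j \<in> S" for j
  proof -
    have "{i\<in>S. f i = f j} = {j}" using assms(2) that by (auto dest: inj_onD)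
    then show ?thesis by (simp add: power2_eq_square)
  qed
  then show ?thesis using square_sum_by_order[OF assms(1), of x f] by simp
qed

text \<open>Abel summation: the coefficients are the drops of \<open>w k / q k\<close>. They do not
  depend on \<open>a\<close>, so one combination serves realised, expected and preemptive mean busy
  dates.\<close>

lemma weighted_sum_prefix_decomposition:
  fixes w q :: "nat \<Rightarrow> real"
  assumes "\<And>j. j \<in> {1..n} \<Longrightarrow> 0 \<le> w j" and "\<And>j. j \<in> {1..n} \<Longrightarrow> 0 < q j"
    and "\<And>i j. i \<in> {1..n} \<Longrightarrow> j \<in> {1..n} \<Longrightarrow> i \<le> j \<Longrightarrow> w j / q j \<le> w i / q i"
  shows "\<exists>\<delta> :: nat \<Rightarrow> real. (\<forall>k\<in>{1..n}. 0 \<le> \<delta> k) \<and>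
    (\<forall>a. (\<Sum>j=1..n. w j * a j) = (\<Sum>k=1..n. \<delta> k * (\<Sum>j=1..k. q j * a j)))"
proof -
  \<comment> \<open>The value 0 beyond \<open>n\<close> makes the last drop
    \<open>w n / q n\<close>, so that the drops from \<open>j\<close> on telescope to
    \<open>w j / q j\<close>.\<close>
  define \<rho> where "\<rho> j = (if j \<le> n then w j / q j else 0)" for j
  define \<delta> where "\<delta> k = \<rho> k - \<rho> (Suc k)" for k
  have nonneg: "0 \<le> \<delta> k" if "k \<in> {1..n}" for k
    using that assms(3)[of k "Suc k"] assms(1)[of k] assms(2)[of k]
    by (auto simp: \<delta>_def \<rho>_def)
  have tele: "(\<Sum>k=j..n. \<delta> k) = w j / q j" if "j \<in> {1..n}" for j
    using sum_Suc_diff[of j n "\<lambda>k. - \<rho> k"] that by (simp add: \<delta>_def \<rho>_def)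
  have "(\<Sum>j=1..n. w j * a j) = (\<Sum>k=1..n. \<delta> k * (\<Sum>j=1..k. q j * a j))" for a
  proof -
    have "(\<Sum>j=1..n. w j * a j) = (\<Sum>j=1..n. \<Sum>k=j..n. \<delta> k * (q j * a j))"
    proof (rule sum.cong[OF refl])
      fix j assume j: "j \<in> {1..n}"
      have "(\<Sum>k=j..n. \<delta> k * (q j * a j)) = w j / q j * (q j * a j)"
        by (simp add: sum_distrib_right[symmetric] tele[OF j])
      then show "w j * a j = (\<Sum>k=j..n. \<delta> k * (q j * a j))"
        using assms(2)[OF j] by simp
    qed
    also have "\<dots> = (\<Sum>(j, k)\<in>(SIGMA j:{1..n}. {j..n}). \<delta> k * (q j * a j))"
      by (rule sum.Sigma) auto
    also have "\<dots> = (\<Sum>(k, j)\<in>(SIGMA k:{1..n}. {1..k}). \<delta> k * (q j * a j))"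
      by (rule sum.reindex_bij_witness[of _ prod.swap prod.swap]) auto
    also have "\<dots> = (\<Sum>k=1..n. \<Sum>j=1..k. \<delta> k * (q j * a j))"
      by (rule sum.Sigma[symmetric]) auto
    finally show ?thesis by (simp add: sum_distrib_left)
  qed
  with nonneg show ?thesis by blast
qed

section \<open>Truncated expectations\<close>

lemma g_le_1: "0 \<le> \<Delta> \<Longrightarrow> g \<Delta> \<le> 1"
  by (auto simp: g_def)

context prob_space begin

lemma CV2_nonneg: "0 \<le> CV2 M X"
  by (simp add: CV2_def)

text \<open>For \<open>\<Delta> \<le> 1\<close>, \<open>min x m\<close> is half of
  \<open>x + m - \<bar>x - m\<bar>\<close>, and the mean absolute deviation is at most the standard
  deviation. For larger \<open>\<Delta>\<close>, a parabola below \<open>min x m\<close> is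
  integrated using the first two moments.\<close>

lemma g_le_expectation_min:
  assumes X: "integrable M X" and X2: "integrable M (\<lambda>\<omega>. (X \<omega>)\<^sup>2)"
    and nonneg: "\<And>\<omega>. \<omega> \<in> space M \<Longrightarrow> 0 \<le> X \<omega>"
    and m: "expectation X = m" "0 < m" and cv: "CV2 M X \<le> \<Delta>"
  shows "g \<Delta> * m \<le> expectation (\<lambda>\<omega>. min (X \<omega>) m)"
proof -
  have var: "variance X \<le> \<Delta> * m\<^sup>2"
    using cv m by (simp add: CV2_def field_simps)
  have \<Delta>: "0 \<le> \<Delta>" using CV2_nonneg[of X] cv by linarith
  show ?thesis
  proof (cases "\<Delta> \<le> 1")
    case True
    define Y where "Y \<omega> = \<bar>X \<omega> - m\<bar>" for \<omega>
    have Y: "integrable M Y" unfolding Y_def using X by auto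
    have Y2: "integrable M (\<lambda>\<omega>. (Y \<omega>)\<^sup>2)"
      unfolding Y_def power2_abs power2_diff using X X2 by auto
    \<comment> \<open>Cauchy-Schwarz for \<open>Y\<close>, in the form that a variance is
      non-negative.\<close>
    have "0 \<le> variance Y" by simp
    then have "(expectation Y)\<^sup>2 \<le> expectation (\<lambda>\<omega>. (Y \<omega>)\<^sup>2)"
      using variance_eq[OF Y Y2] by simp
    also have "\<dots> = variance X" by (simp add: Y_def m)
    finally have "(expectation Y)\<^sup>2 \<le> (sqrt \<Delta> * m)\<^sup>2"
      using var \<Delta> by (simp add: power_mult_distrib)
    then have "expectation Y \<le> sqrt \<Delta> * m"
      by (rule power2_le_imp_le) (use \<Delta> m in simp)
    moreover have "expectation (\<lambda>\<omega>. min (X \<omega>) m) = expectation (\<lambda>\<omega>. (X \<omega> + m - Y \<omega>) / 2)"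
      by (intro Bochner_Integration.integral_cong) (auto simp: Y_def)
    moreover have "\<dots> = (m + m - expectation Y) / 2"
      using X Y m by (simp add: prob_space)
    ultimately show ?thesis using True by (simp add: g_def field_simps)
  next
    case False
    define y where "y = (\<Delta> + 1) * m"
    have y: "2 * m \<le> y" "0 < y" using False m by (auto simp: y_def)
    \<comment> \<open>The parabola touches \<open>min x m\<close> at \<open>0\<close> and at \<open>y\<close>, the atoms of the extremal law.\<close>
    have parabola: "2 * m / y * x - m / y\<^sup>2 * x\<^sup>2 \<le> min x m" if "0 \<le> x" for x
    proof -
      have "0 \<le> m * (1 - x / y)\<^sup>2" using m by simp
      then have "2 * m / y * x - m / y\<^sup>2 * x\<^sup>2 \<le> m"
        using y by (simp add: power2_eq_square field_simps)
      moreover have "2 * m / y * x \<le> 1 * x" using y that by (intro mult_right_mono) auto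
      moreover have "0 \<le> m / y\<^sup>2 * x\<^sup>2" using m by simp
      ultimately show ?thesis by simp
    qed
    have "expectation (\<lambda>\<omega>. (X \<omega>)\<^sup>2) \<le> (\<Delta> + 1) * m\<^sup>2"
      using variance_eq[OF X X2] var m by (simp add: algebra_simps)
    then have "m / y\<^sup>2 * expectation (\<lambda>\<omega>. (X \<omega>)\<^sup>2) \<le> m / y\<^sup>2 * ((\<Delta> + 1) * m\<^sup>2)"
      using m by (intro mult_left_mono) auto
    also have "\<dots> = m / (\<Delta> + 1)"
    proof -
      have "m / (D * m)\<^sup>2 * (D * m\<^sup>2) = m / D" if "0 < D" for D
        using that m by (simp add: power2_eq_square field_simps)
      from this[of "\<Delta> + 1"] show ?thesis using False by (simp add: y_def)
    qed
    finally have "m / y\<^sup>2 * expectation (\<lambda>\<omega>. (X \<omega>)\<^sup>2) \<le> m / (\<Delta> + 1)" .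
    moreover have "2 * m / y * m = m / (\<Delta> + 1) + m / (\<Delta> + 1)"
      using m by (simp add: y_def)
    ultimately have "g \<Delta> * m \<le> 2 * m / y * m - m / y\<^sup>2 * expectation (\<lambda>\<omega>. (X \<omega>)\<^sup>2)"
      using False by (simp add: g_def)
    also have "\<dots> = expectation (\<lambda>\<omega>. 2 * m / y * X \<omega> - m / y\<^sup>2 * (X \<omega>)\<^sup>2)"
      using X X2 m by (subst Bochner_Integration.integral_diff) auto
    also have "\<dots> \<le> expectation (\<lambda>\<omega>. min (X \<omega>) m)"
      using X X2 parabola nonneg
      by (intro integral_mono integrable_min Bochner_Integration.integrable_diff) auto
    finally show ?thesis .
  qed
qed

text \<open>The maximum is \<open>x + \<beta> * m - min x (\<beta> * m)\<close>, and this minimum is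
  at least \<open>\<beta> * min x m\<close> because \<open>\<beta> \<le> 1\<close>.\<close>

lemma expectation_max_le:
  assumes X: "integrable M X" and X2: "integrable M (\<lambda>\<omega>. (X \<omega>)\<^sup>2)"
    and nonneg: "\<And>\<omega>. \<omega> \<in> space M \<Longrightarrow> 0 \<le> X \<omega>"
    and m: "expectation X = m" "0 < m" and cv: "CV2 M X \<le> \<Delta>"
    and \<beta>: "0 \<le> \<beta>" "\<beta> \<le> 1"
  shows "expectation (\<lambda>\<omega>. max (X \<omega>) (\<beta> * m)) \<le> (1 + \<beta> * (1 - g \<Delta>)) * m"
proof -
  have "max x (\<beta> * m) \<le> x + \<beta> * m - \<beta> * min x m" if "0 \<le> x" for x
  proof -
    have "\<beta> * min x m \<le> \<beta> * m" "\<beta> * min x m \<le> x"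
      using \<beta> that mult_mono[of \<beta> 1 "min x m" x] m by (auto intro: mult_left_mono)
    then show ?thesis by simp
  qed
  then have "expectation (\<lambda>\<omega>. max (X \<omega>) (\<beta> * m))
      \<le> expectation (\<lambda>\<omega>. X \<omega> + \<beta> * m - \<beta> * min (X \<omega>) m)"
    using X nonneg by (intro integral_mono integrable_max) auto
  also have "\<dots> = m + \<beta> * m - \<beta> * expectation (\<lambda>\<omega>. min (X \<omega>) m)"
    using X m by (simp add: prob_space)
  also have "\<dots> \<le> m + \<beta> * m - \<beta> * (g \<Delta> * m)"
    using g_le_expectation_min[OF X X2 nonneg m cv] \<beta> by (simp add: mult_left_mono)
  finally show ?thesis by (simp add: algebra_simps)
qed

end

section \<open>Blocks of the preemptive schedule\<close>

locale WSPT_schedule =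
  fixes n :: nat and r q :: "nat \<Rightarrow> real" and I :: "nat \<Rightarrow> real \<Rightarrow> real"
  assumes release_nonneg: "j \<in> {1..n} \<Longrightarrow> 0 \<le> r j"
    and length_pos: "j \<in> {1..n} \<Longrightarrow> 0 < q j"
    and WSPT: "preemptive_WSPT n r q I"
begin

text \<open>\<open>preemptive_WSPT\<close> fixes \<open>I\<close> only at times
  \<open>t \<ge> 0\<close>, whence the restriction to such times.\<close>

definition busy :: "nat \<Rightarrow> real set" where
  "busy j = {t. 0 \<le> t \<and> I j t = 1}"

abbreviation work :: "nat \<Rightarrow> real \<Rightarrow> real" where
  "work \<equiv> processed I"

abbreviation avail :: "nat \<Rightarrow> real \<Rightarrow> bool" where
  "avail \<equiv> available r q I"

lemma I_eq_indicator: "j \<in> {1..n} \<Longrightarrow> 0 \<le> t \<Longrightarrow> I j t = indicator (busy j) t"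
  using WSPT unfolding preemptive_WSPT_def busy_def indicator_def by auto

lemma busy_iff:
  assumes "j \<in> {1..n}"
  shows "t \<in> busy j \<longleftrightarrow> avail j t \<and> (\<forall>k\<in>{1..<j}. \<not> avail k t)"
proof (cases "0 \<le> t")
  case True
  then show ?thesis
    using WSPT assms unfolding preemptive_WSPT_def busy_def by auto
next
  case False
  then show ?thesis
    using release_nonneg[OF assms] by (auto simp: busy_def available_def)
qed

lemma busy_borel [measurable]:
  assumes "j \<in> {1..n}"
  shows "busy j \<in> sets borel"
proof -
  have "(\<lambda>x. indicator {0..} x *\<^sub>R I j x) \<in> borel_measurable borel"
    using WSPT assms unfolding preemptive_WSPT_def set_borel_measurable_def by auto
  then have "{x \<in> space borel. indicator {0..} x *\<^sub>R I j x = 1} \<in> sets borel"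
    by measurable
  moreover have "{x \<in> space borel. indicator {0..} x *\<^sub>R I j x = 1} = busy j"
    by (auto simp: busy_def indicator_def split: if_splits)
  ultimately show ?thesis by simp
qed

lemma busy_unique:
  assumes "i \<in> {1..n}" "j \<in> {1..n}" "t \<in> busy i" "t \<in> busy j"
  shows "i = j"
  using assms busy_iff[OF assms(1), of t] busy_iff[OF assms(2), of t]
  by (cases i j rule: linorder_cases) auto

lemma disjoint_family_on_busy: "J \<subseteq> {1..n} \<Longrightarrow> disjoint_family_on busy J"
  unfolding disjoint_family_on_def using busy_unique by blast

lemma fmeasurable_busy: "j \<in> {1..n} \<Longrightarrow> busy j \<inter> {a..b} \<in> fmeasurable lborel"
  by (rule fmeasurableI2[of "{a..b}"]) (auto simp: fmeasurable_def emeasure_lborel_Icc_eq)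

lemma work_eq:
  assumes "j \<in> {1..n}"
  shows "work j t = measure lborel (busy j \<inter> {0..t})"
proof -
  have "work j t = integral\<^sup>L lborel (indicator (busy j \<inter> {0..t}))"
    unfolding processed_def set_lebesgue_integral_def
    by (intro Bochner_Integration.integral_cong)
      (auto simp: indicator_def I_eq_indicator[OF assms])
  then show ?thesis using assms by simp
qed

lemma work_mono: "j \<in> {1..n} \<Longrightarrow> s \<le> t \<Longrightarrow> work j s \<le> work j t"
  unfolding work_eq by (intro measure_mono_fmeasurable fmeasurable_busy) auto

lemma work_0: "j \<in> {1..n} \<Longrightarrow> work j 0 = 0"
  using measure_mono_fmeasurable[of "busy j \<inter> {0..0}" "{0::real}" lborel]
  by (auto simp: work_eq fmeasurable_def intro!: antisym)

text \<open>The work gained after \<open>s\<close> is the measure of a subset of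
  \<open>{s..t}\<close>. With monotonicity this yields the continuity behind the intermediate value
  arguments.\<close>

lemma work_diff_le:
  assumes "j \<in> {1..n}" "s \<le> t"
  shows "work j t \<le> work j s + (t - s)"
proof -
  have "work j t \<le> measure lborel ((busy j \<inter> {0..s}) \<union> {s..t})"
    unfolding work_eq[OF assms(1)] using assms
    by (intro measure_mono_fmeasurable fmeasurable.Un fmeasurable_busy)
      (auto simp: fmeasurable_def emeasure_lborel_Icc_eq)
  also have "\<dots> \<le> measure lborel (busy j \<inter> {0..s}) + measure lborel {s..t}"
    using assms by (intro measure_Un_le) auto
  finally show ?thesis using assms by (simp add: work_eq)
qed

lemma work_continuous:
  assumes "j \<in> {1..n}"
  shows "continuous_on S (work j)"
proof (rule continuous_onI)
  fix x e :: real assume "0 < e"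
  have "dist (work j y) (work j x) \<le> e" if "dist y x < e" for y
    using that work_diff_le[OF assms, of x y] work_diff_le[OF assms, of y x]
      work_mono[OF assms, of x y] work_mono[OF assms, of y x]
    by (cases "x \<le> y") (auto simp: dist_real_def)
  then show "\<exists>d>0. \<forall>y\<in>S. dist y x < d \<longrightarrow> dist (work j y) (work j x) \<le> e"
    using \<open>0 < e\<close> by blast
qed

lemma work_idle:
  assumes "j \<in> {1..n}" "q j \<le> work j u" "u \<le> t"
  shows "work j t = work j u"
proof -
  have "\<not> avail j s" if "u \<le> s" for s
    using work_mono[OF assms(1) that] assms(2) by (simp add: available_def)
  then have "busy j \<inter> {0..t} = busy j \<inter> {0..u}"
    using assms busy_iff[OF assms(1)] by (auto simp: not_le) (meson le_cases)
  then show ?thesis by (simp add: work_eq[OF assms(1)])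
qed

text \<open>If the work exceeded \<open>q j\<close>, continuity would give an earlier time at which
  it equals \<open>q j\<close>, and from there on \<open>work_idle\<close> freezes it.\<close>

lemma work_le:
  assumes "j \<in> {1..n}"
  shows "work j t \<le> q j"
proof (rule ccontr)
  assume *: "\<not> work j t \<le> q j"
  have "0 \<le> t"
    using * length_pos[OF assms] by (auto simp: work_eq[OF assms] intro: ccontr)
  then obtain u where "0 \<le> u" "u \<le> t" "work j u = q j"
    using IVT'[of "work j" 0 "q j" t] work_0[OF assms] length_pos[OF assms] *
      work_continuous[OF assms] by auto
  then show False using work_idle[OF assms, of u t] * by simp
qed

text \<open>The least available index is the one served. So the machine never idles while
  \<open>j\<close> waits.\<close>

lemma least_available_busy:
  assumes "avail j t" "j \<in> {1..n}"
  obtains i where "i \<in> {1..j}" "t \<in> busy i"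
proof -
  define m where "m = (LEAST k. k \<in> {1..j} \<and> avail k t)"
  have m: "m \<in> {1..j}" "avail m t"
    using LeastI[of "\<lambda>k. k \<in> {1..j} \<and> avail k t" j] assms unfolding m_def by auto
  have "\<not> avail i t" if "i \<in> {1..<m}" for i
    using not_less_Least[of i "\<lambda>k. k \<in> {1..j} \<and> avail k t"] that m(1)
    unfolding m_def[symmetric] by auto
  then have "t \<in> busy m" using m assms(2) busy_iff[of m t] by auto
  then show ?thesis using that m by blast
qed

text \<open>Subadditivity of measure. The interval is half-open because at an \<alpha>-point itself
  the cover may already fail, for instance at the completion of the last job.\<close>

lemma interval_le_work:
  assumes "J \<subseteq> {1..n}" "0 \<le> a" "a \<le> u" "{a..<u} \<subseteq> (\<Union>i\<in>J. busy i)"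
  shows "u - a \<le> (\<Sum>i\<in>J. work i u)"
proof -
  have fin: "finite J" using assms(1) finite_subset by blast
  have "u - a = measure lborel {a..<u}" using assms by simp
  also have "\<dots> \<le> measure lborel (\<Union>i\<in>J. busy i \<inter> {0..u})"
    using assms fin
    by (intro measure_mono_fmeasurable fmeasurable.finite_UN fmeasurable_busy) fastforce+
  also have "\<dots> \<le> (\<Sum>i\<in>J. measure lborel (busy i \<inter> {0..u}))"
    using fin assms by (intro measure_UNION_le) auto
  also have "\<dots> = (\<Sum>i\<in>J. work i u)"
    using assms(1) by (intro sum.cong) (auto simp: work_eq)
  finally show ?thesis .
qed

lemma sum_work_le:
  assumes "J \<subseteq> {1..n}" "0 \<le> t"
  shows "(\<Sum>i\<in>J. work i t) \<le> t"
proof -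
  have fin: "finite J" using assms(1) finite_subset by blast
  have "(\<Sum>i\<in>J. work i t) = (\<Sum>i\<in>J. measure lborel (busy i \<inter> {0..t}))"
    using assms(1) by (intro sum.cong) (auto simp: work_eq)
  also have "\<dots> = measure lborel (\<Union>i\<in>J. busy i \<inter> {0..t})"
    using assms fin disjoint_family_on_busy[OF assms(1)]
    by (intro measure_finite_Union[symmetric])
      (auto simp: disjoint_family_on_def intro!: fmeasurableD2 fmeasurable_busy)
  also have "\<dots> \<le> measure lborel {0..t}"
    using assms(1) fin
    by (intro measure_mono_fmeasurable sets.finite_UN)
      (auto simp: fmeasurable_def emeasure_lborel_Icc_eq)
  finally show ?thesis using assms by simp
qed

text \<open>A job that never finished would keep the machine on the jobs \<open>1, ..., j\<close>
  forever after \<open>r j\<close>, although their total length is finite.\<close>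

lemma eventually_finished:
  assumes j: "j \<in> {1..n}"
  shows "\<exists>t\<ge>0. work j t = q j"
proof (rule ccontr)
  assume "\<not> ?thesis"
  then have un: "work j t < q j" if "0 \<le> t" for t
    using that work_le[OF j, of t] by (auto simp: less_le)
  define u where "u = r j + (\<Sum>i\<in>{1..j}. q i) + 1"
  have rj: "0 \<le> r j" using release_nonneg j by auto
  have "0 \<le> (\<Sum>i\<in>{1..j}. q i)"
    using j length_pos by (intro sum_nonneg less_imp_le) auto
  moreover have "u - r j \<le> (\<Sum>i\<in>{1..j}. work i u)"
  proof (rule interval_le_work)
    show "{r j..<u} \<subseteq> (\<Union>i\<in>{1..j}. busy i)"
    proof
      fix t assume "t \<in> {r j..<u}"
      then have "avail j t" using un[of t] rj by (auto simp: available_def)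
      then show "t \<in> (\<Union>i\<in>{1..j}. busy i)"
        using least_available_busy[OF _ j] by blast
    qed
  qed (use j rj calculation in \<open>auto simp: u_def\<close>)
  moreover have "(\<Sum>i\<in>{1..j}. work i u) \<le> (\<Sum>i\<in>{1..j}. q i)"
    using j by (intro sum_mono work_le) auto
  ultimately show False by (simp add: u_def)
qed

lemma measure_busy:
  assumes j: "j \<in> {1..n}"
  shows "busy j \<in> fmeasurable lborel" "measure lborel (busy j) = q j"
proof -
  obtain T where T: "0 \<le> T" "work j T = q j"
    using eventually_finished[OF j] by blast
  have "busy j \<subseteq> {0..T}"
  proof
    fix t assume t: "t \<in> busy j"
    then have "avail j t" "0 \<le> t" using busy_iff[OF j] by (auto simp: busy_def)
    then show "t \<in> {0..T}"
      using work_mono[OF j, of T t] T by (auto simp: available_def intro: ccontr)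
  qed
  then have "busy j = busy j \<inter> {0..T}" by blast
  then show "busy j \<in> fmeasurable lborel" "measure lborel (busy j) = q j"
    using fmeasurable_busy[OF j, of 0 T] T work_eq[OF j, of T] by simp_all
qed

lemma avail_between: "j \<in> {1..n} \<Longrightarrow> avail j s \<Longrightarrow> r j \<le> t \<Longrightarrow> t \<le> s \<Longrightarrow> avail j t"
  using work_mono[of j t s] by (auto simp: available_def)

text \<open>Before its release \<open>j\<close> is not served, so the work done up to
  \<open>r j\<close> is the measure of a null set.\<close>

lemma avail_release:
  assumes j: "j \<in> {1..n}"
  shows "avail j (r j)"
proof -
  have "busy j \<inter> {0..r j} \<subseteq> {r j}"
    using busy_iff[OF j] by (auto simp: available_def)
  then have "work j (r j) \<le> measure lborel {r j}"
    unfolding work_eq[OF j] using j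
    by (intro measure_mono_fmeasurable) (auto simp: fmeasurable_def)
  then show ?thesis using length_pos[OF j] by (simp add: available_def)
qed

text \<open>By continuity of \<open>work j\<close> the set of candidates is closed, so its infimum
  is the element that \<open>LEAST\<close> denotes. Continuity also yields a time no later than that
  with work exactly \<open>\<alpha> * q j\<close>; minimality makes the two coincide.\<close>

lemma
  assumes j: "j \<in> {1..n}" and \<alpha>: "0 < \<alpha>" "\<alpha> \<le> 1"
  shows alpha_point_nonneg: "0 \<le> alpha_point q I \<alpha> j"
    and work_alpha_point: "work j (alpha_point q I \<alpha> j) = \<alpha> * q j"
    and work_before_alpha_point: "t < alpha_point q I \<alpha> j \<Longrightarrow> work j t < \<alpha> * q j"
proof -
  define S where "S = {t. 0 \<le> t \<and> \<alpha> * q j \<le> work j t}"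
  have pos: "0 < \<alpha> * q j" "\<alpha> * q j \<le> q j" using \<alpha> length_pos[OF j] by auto
  obtain T where "0 \<le> T" "work j T = q j" using eventually_finished[OF j] by blast
  then have "T \<in> S" using pos by (simp add: S_def)
  moreover have "closed S"
    unfolding S_def using work_continuous[OF j, of UNIV]
    by (intro closed_Collect_conj closed_Collect_le continuous_on_const continuous_on_id)
  moreover have bdd: "bdd_below S" unfolding S_def by (auto intro!: bdd_belowI[of _ 0])
  ultimately have "Inf S \<in> S" by (intro closed_contains_Inf) auto
  moreover have "Inf S \<le> t" if "t \<in> S" for t using that bdd by (rule cInf_lower)
  ultimately have C: "alpha_point q I \<alpha> j = Inf S"
    unfolding alpha_point_def S_def by (intro Least_equality) auto
  have least: "work j t < \<alpha> * q j" if "t < alpha_point q I \<alpha> j" for t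
  proof (cases "0 \<le> t")
    case True
    then show ?thesis using that cInf_lower[OF _ bdd, of t] unfolding C by (force simp: S_def)
  next
    case False
    then show ?thesis using pos by (simp add: work_eq[OF j])
  qed
  show "t < alpha_point q I \<alpha> j \<Longrightarrow> work j t < \<alpha> * q j" by (rule least)
  show nn: "0 \<le> alpha_point q I \<alpha> j" using \<open>Inf S \<in> S\<close> by (simp add: C S_def)
  have ge: "\<alpha> * q j \<le> work j (alpha_point q I \<alpha> j)"
    using \<open>Inf S \<in> S\<close> by (simp add: C S_def)
  then obtain u where u: "0 \<le> u" "u \<le> alpha_point q I \<alpha> j" "work j u = \<alpha> * q j"
    using IVT'[of "work j" 0 "\<alpha> * q j" "alpha_point q I \<alpha> j"] nn pos
      work_0[OF j] work_continuous[OF j] by auto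
  then have "u = alpha_point q I \<alpha> j" using least[of u] by force
  then show "work j (alpha_point q I \<alpha> j) = \<alpha> * q j" using u by simp
qed

section \<open>Maximal busy intervals of the prefixes 1, ..., k\<close>

definition running :: "nat \<Rightarrow> real \<Rightarrow> bool" where
  "running k t \<longleftrightarrow> (\<exists>i\<in>{1..k}. avail i t)"

text \<open>The left end of the maximal interval around \<open>r j\<close> on which the prefix
  always has an available job. Such an interval begins at a release date, so a minimum over finitely
  many dates describes it.\<close>

definition block_start :: "nat \<Rightarrow> nat \<Rightarrow> real" where
  "block_start k j = Min (r ` {i\<in>{1..k}. r i \<le> r j \<and> (\<forall>t\<in>{r i..r j}. running k t)})"

definition block :: "nat \<Rightarrow> real \<Rightarrow> nat set" where
  "block k b = {j\<in>{1..k}. block_start k j = b}"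

lemma block_start_obtains:
  assumes "j \<in> {1..k}" "k \<le> n"
  obtains m where "m \<in> {1..k}" "block_start k j = r m" "r m \<le> r j"
    "\<forall>t\<in>{r m..r j}. running k t"
proof -
  let ?S = "{i\<in>{1..k}. r i \<le> r j \<and> (\<forall>t\<in>{r i..r j}. running k t)}"
  have "j \<in> ?S" using assms avail_release[of j] by (auto simp: running_def)
  then have "block_start k j \<in> r ` ?S"
    unfolding block_start_def by (intro Min_in) auto
  then show ?thesis using that by blast
qed

lemma block_start_le:
  assumes "i \<in> {1..k}" "r i \<le> r j" "\<forall>t\<in>{r i..r j}. running k t"
  shows "block_start k j \<le> r i"
  unfolding block_start_def using assms by (intro Min_le) auto

text \<open>The interval from \<open>r i\<close> to \<open>s\<close> is kept running by
  \<open>i\<close>, and the one from \<open>block_start k j\<close> to \<open>s\<close> by the block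
  of \<open>j\<close> or by \<open>j\<close> itself. They meet at \<open>s\<close>, so both belong
  to one busy interval.\<close>

lemma block_start_same:
  assumes k: "k \<le> n" and i: "i \<in> {1..k}" and j: "j \<in> {1..k}"
    and s: "avail i s" "block_start k j \<le> s" "s \<le> r j \<or> avail j s"
  shows "block_start k i = block_start k j"
proof -
  obtain m where m: "m \<in> {1..k}" "block_start k j = r m" "r m \<le> r j"
    "\<forall>t\<in>{r m..r j}. running k t"
    using block_start_obtains[OF j k] by metis
  have ris: "r i \<le> s" using s by (simp add: available_def)
  have run_i: "running k t" if "t \<in> {r i..s}" for t
    using avail_between[of i s t] that i k s unfolding running_def by auto
  have run_j: "running k t" if "t \<in> {r m..s}" for t
  proof (cases "t \<le> r j")
    case True then show ?thesis using m that by auto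
  next
    case False
    then have "avail j s" using s that by auto
    then show ?thesis
      using False avail_between[of j s t] that j k unfolding running_def by auto
  qed
  \<comment> \<open>A release of \<open>i\<close> before the block would extend the block of
    \<open>j\<close> to the left, against minimality.\<close>
  have mi: "r m \<le> r i"
  proof (rule ccontr)
    assume "\<not> r m \<le> r i"
    moreover have "running k t" if "t \<in> {r i..r j}" for t
      using that run_i[of t] m(2,4) s(2) by (cases "t \<le> r m") auto
    ultimately have "block_start k j \<le> r i" using i m by (intro block_start_le) auto
    then show False using \<open>\<not> r m \<le> r i\<close> m by simp
  qed
  \<comment> \<open>Each start is now a candidate in the minimum that defines the other.\<close>
  have "block_start k i \<le> r m"
    using m mi run_j ris by (intro block_start_le) auto
  moreover obtain m' where m': "m' \<in> {1..k}" "block_start k i = r m'" "r m' \<le> r i"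
    "\<forall>t\<in>{r m'..r i}. running k t"
    using block_start_obtains[OF i k] by metis
  moreover have "running k t" if "t \<in> {r m'..r j}" for t
    using that m'(4) m(4) mi by (cases "t \<le> r i") auto
  then have "block_start k j \<le> r m'"
    using m m' calculation(1) by (intro block_start_le) auto
  ultimately show ?thesis using m by simp
qed

text \<open>Up to \<open>r j\<close> the choice of the block start keeps the prefix running, and
  afterwards \<open>j\<close> does so while available. The job served then lies in the prefix, and
  by \<open>block_start_same\<close> in the block.\<close>

lemma block_covers:
  assumes k: "k \<le> n" and j: "j \<in> block k b" and s: "b \<le> s" "s \<le> r j \<or> avail j s"
  obtains i where "i \<in> block k b" "s \<in> busy i"
proof -
  have j': "j \<in> {1..k}" "block_start k j = b" using j by (auto simp: block_def)
  obtain m where m: "block_start k j = r m" "\<forall>t\<in>{r m..r j}. running k t"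
    using block_start_obtains[OF j'(1) k] by metis
  have "running k s"
    using s m j' by (cases "s \<le> r j") (auto simp: running_def)
  then obtain l where "l \<in> {1..k}" "avail l s" by (auto simp: running_def)
  then obtain i where i: "i \<in> {1..k}" "s \<in> busy i"
    using least_available_busy[of l s] k by (metis atLeastAtMost_iff le_trans)
  have "avail i s" using busy_iff[of i s] i k by auto
  then have "block_start k i = b"
    using block_start_same[OF k i(1) j'(1)] s j'(2) by simp
  then show ?thesis using that i by (auto simp: block_def)
qed

lemma block_subset: "k \<le> n \<Longrightarrow> block k b \<subseteq> {1..n}"
  by (auto simp: block_def)

lemma block_release:
  assumes "k \<le> n" "j \<in> block k b"
  shows "0 \<le> b" "b \<le> r j"
proof -
  have j': "j \<in> {1..k}" "block_start k j = b" using assms by (auto simp: block_def)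
  obtain m where m: "m \<in> {1..k}" "block_start k j = r m" "r m \<le> r j"
    using block_start_obtains[OF j'(1) assms(1)] by metis
  then show "0 \<le> b" "b \<le> r j" using j' release_nonneg[of m] assms(1) by auto
qed

text \<open>When \<open>j\<close> is served at \<open>t\<close>, all the time from \<open>b\<close>
  to \<open>t\<close> has been spent on the block, whose total length thus bounds
  \<open>t - b\<close>.\<close>

lemma block_busy_subset:
  assumes k: "k \<le> n" and j: "j \<in> block k b"
  shows "busy j \<subseteq> {b..b + (\<Sum>i\<in>block k b. q i)}"
proof
  fix t assume t: "t \<in> busy j"
  have jn: "j \<in> {1..n}" using block_subset[OF k] j by blast
  have av: "avail j t" using busy_iff[OF jn] t by blast
  have bt: "b \<le> t" using av block_release[OF k j] by (auto simp: available_def)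
  have "t - b \<le> (\<Sum>i\<in>block k b. work i t)"
  proof (rule interval_le_work[OF block_subset[OF k] _ bt])
    show "0 \<le> b" using block_release[OF k j] by simp
    show "{b..<t} \<subseteq> (\<Union>i\<in>block k b. busy i)"
    proof
      fix s assume s: "s \<in> {b..<t}"
      then have "s \<le> r j \<or> avail j s" using avail_between[OF jn av, of s] by fastforce
      then show "s \<in> (\<Union>i\<in>block k b. busy i)"
        using block_covers[OF k j, of s] s by (metis UN_I atLeastLessThan_iff)
    qed
  qed
  also have "\<dots> \<le> (\<Sum>i\<in>block k b. q i)"
    using subsetD[OF block_subset[OF k]] by (intro sum_mono work_le) blast
  finally show "t \<in> {b..b + (\<Sum>i\<in>block k b. q i)}" using bt by simp
qed

text \<open>The busy sets of the block are disjoint subsets of \<open>{b..b + P}\<close> of total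
  measure \<open>P\<close>. They fill it up to a null set, so their first moments add up to the
  integral of \<open>t\<close> over the interval.\<close>

lemma block_mean_busy_date:
  assumes k: "k \<le> n" and P: "P = (\<Sum>j\<in>block k b. q j)"
  shows "(\<Sum>j\<in>block k b. q j * preemptive_mean_busy_date q I j) = b * P + P\<^sup>2 / 2"
proof -
  let ?B = "block k b" and ?U = "\<Union>j\<in>block k b. busy j"
  have B: "j \<in> {1..n}" if "j \<in> ?B" for j using block_subset[OF k] that by blast
  have fin: "finite ?B" by (simp add: block_def)
  have P0: "0 \<le> P" unfolding P using B length_pos by (intro sum_nonneg less_imp_le) auto
  have U: "?U \<subseteq> {b..b + P}" unfolding P using block_busy_subset[OF k] by blast
  have Um: "?U \<in> sets lborel" using fin B by (intro sets.finite_UN) auto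
  have UP: "measure lborel ?U = P"
    unfolding P using fin B measure_busy disjoint_family_on_busy[OF block_subset[OF k]]
    by (subst measure_finite_Union) (auto dest: fmeasurableD2)
  have int: "integrable lborel (\<lambda>t. indicator (busy j) t * t)" if "j \<in> ?B" for j
  proof -
    have "set_integrable lborel {b..b + P} (\<lambda>t. t)"
      by (intro borel_integrable_atLeastAtMost') auto
    then have "set_integrable lborel (busy j) (\<lambda>t. t)"
    proof (rule set_integrable_subset)
      show "busy j \<in> sets lborel" using B[OF that] by simp
      show "busy j \<subseteq> {b..b + P}" using that U by blast
    qed
    then show ?thesis by (simp add: set_integrable_def)
  qed
  have one: "q j * preemptive_mean_busy_date q I j = (\<integral>t. indicator (busy j) t * t \<partial>lborel)"
    if "j \<in> ?B" for j
  proof -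
    have "indicator {0..} t *\<^sub>R (I j t * t) = indicator (busy j) t * t" for t
    proof (cases "0 \<le> t")
      case True
      then show ?thesis using I_eq_indicator[OF B[OF that] True] by simp
    next
      case False
      then show ?thesis by (simp add: busy_def)
    qed
    then have "(LINT t:{0..}|lborel. I j t * t) = (\<integral>t. indicator (busy j) t * t \<partial>lborel)"
      by (simp only: set_lebesgue_integral_def)
    then show ?thesis
      using length_pos[OF B[OF that]] by (simp add: preemptive_mean_busy_date_def)
  qed
  have disj: "(\<Sum>j\<in>?B. indicator (busy j) t) = (indicator ?U t :: real)" for t
    using fin disjoint_family_on_busy[OF block_subset[OF k]]
    by (rule indicator_UN_disjoint[symmetric])
  have "(\<Sum>j\<in>?B. q j * preemptive_mean_busy_date q I j)
      = (\<Sum>j\<in>?B. \<integral>t. indicator (busy j) t * t \<partial>lborel)"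
    using one by (intro sum.cong) auto
  also have "\<dots> = (\<integral>t. (\<Sum>j\<in>?B. indicator (busy j) t * t) \<partial>lborel)"
    using int by (intro Bochner_Integration.integral_sum[symmetric]) auto
  also have "\<dots> = (\<integral>t. t ^ 1 * indicator ?U t \<partial>lborel)"
    by (simp add: disj[symmetric] sum_distrib_left mult.commute)
  also have "\<dots> = (\<integral>t. t ^ 1 * indicator {b..b + P} t \<partial>lborel)"
  proof (rule integral_cong_AE)
    have fm: "{b..b + P} \<in> fmeasurable lborel"
      by (simp add: fmeasurable_def emeasure_lborel_Icc_eq)
    then have "?U \<in> fmeasurable lborel" using U Um by (rule fmeasurableI2)
    then have "measure lborel ({b..b + P} - ?U) = 0"
      using fm U UP P0 Um by (subst measurable_measure_Diff) auto
    moreover have "{b..b + P} - ?U \<in> fmeasurable lborel"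
      using fm Um by (intro fmeasurable_Diff)
    ultimately have "{b..b + P} - ?U \<in> null_sets lborel"
      by (auto simp: null_sets_def emeasure_eq_measure2 fmeasurableD)
    then show "AE t in lborel. t ^ 1 * indicator ?U t = t ^ 1 * (indicator {b..b + P} t :: real)"
      by (rule AE_I') (use U in \<open>auto simp: indicator_def\<close>)
  qed (use Um in measurable)
  also have "\<dots> = b * P + P\<^sup>2 / 2"
    using P0 by (subst integral_power) (auto simp: power2_eq_square algebra_simps)
  finally show ?thesis .
qed

text \<open>Before \<open>C j\<close> the job \<open>j\<close> is unfinished, so the time from
  \<open>b\<close> on is covered by the block. By \<open>C j\<close> a job has received at most an
  \<alpha>-fraction of its length, unless its own \<alpha>-point is earlier.\<close>

lemma block_alpha_point_le:
  fixes \<alpha> :: real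
  defines "C \<equiv> alpha_point q I \<alpha>"
  assumes k: "k \<le> n" and j: "j \<in> block k b" and \<alpha>: "0 < \<alpha>" "\<alpha> \<le> 1"
  shows "C j \<le> b + \<alpha> * (\<Sum>i\<in>block k b. q i)
      + (\<Sum>i\<in>{i\<in>block k b. C i < C j}. (1 - \<alpha>) * q i)"
proof -
  have B: "i \<in> {1..n}" if "i \<in> block k b" for i using block_subset[OF k] that by blast
  show ?thesis
  proof (cases "b \<le> C j")
    case True
    let ?B = "block k b"
    have q: "0 < q i" if "i \<in> ?B" for i using length_pos B that by auto
    have fin: "finite ?B" by (simp add: block_def)
    have "C j - b \<le> (\<Sum>i\<in>?B. work i (C j))"
    proof (rule interval_le_work[OF block_subset[OF k] _ True])
      show "0 \<le> b" using block_release[OF k j] by simp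
      show "{b..<C j} \<subseteq> (\<Union>i\<in>?B. busy i)"
      proof
        fix s assume s: "s \<in> {b..<C j}"
        have "work j s < \<alpha> * q j"
          using s work_before_alpha_point[OF B[OF j] \<alpha>] by (simp add: C_def)
        also have "\<dots> \<le> q j" using \<alpha> q[OF j] by simp
        finally have "s \<le> r j \<or> avail j s" by (auto simp: available_def)
        then show "s \<in> (\<Union>i\<in>?B. busy i)"
          using block_covers[OF k j, of s] s by (metis UN_I atLeastLessThan_iff)
      qed
    qed
    also have "\<dots> \<le> (\<Sum>i\<in>?B. \<alpha> * q i + (if C i < C j then (1 - \<alpha>) * q i else 0))"
    proof (rule sum_mono)
      fix i assume i: "i \<in> ?B"
      show "work i (C j) \<le> \<alpha> * q i + (if C i < C j then (1 - \<alpha>) * q i else 0)"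
        using work_le[OF B[OF i], of "C j"] work_mono[OF B[OF i], of "C j" "C i"]
          work_alpha_point[OF B[OF i] \<alpha>] by (auto simp: C_def algebra_simps)
    qed
    also have "\<dots> = \<alpha> * (\<Sum>i\<in>?B. q i) + (\<Sum>i\<in>{i\<in>?B. C i < C j}. (1 - \<alpha>) * q i)"
      using fin by (simp add: sum.distrib sum_distrib_left sum.inter_filter)
    finally show ?thesis by simp
  next
    case False
    have "0 \<le> (\<Sum>i\<in>block k b. q i)" "0 \<le> (\<Sum>i\<in>{i\<in>block k b. C i < C j}. (1 - \<alpha>) * q i)"
      using B length_pos \<alpha> by (auto intro!: sum_nonneg mult_nonneg_nonneg intro: less_imp_le)
    then show ?thesis using False \<alpha> by (simp add: add_increasing2)
  qed
qed

text \<open>Job \<open>i\<close> is served at some \<open>t\<close> between \<open>b\<close> and its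
  \<alpha>-point. At \<open>t\<close> job \<open>j\<close> is not yet finished, so
  \<open>block_covers\<close> places the job served at \<open>t\<close> in the block.\<close>

lemma block_alpha_point_closed:
  fixes \<alpha> :: real
  defines "C \<equiv> alpha_point q I \<alpha>"
  assumes k: "k \<le> n" and j: "j \<in> block k b" and \<alpha>: "0 < \<alpha>" "\<alpha> \<le> 1"
    and i: "i \<in> {1..n}" "C i < C j" "b < C i"
  shows "i \<in> block k b"
proof -
  have jn: "j \<in> {1..n}" using block_subset[OF k] j by blast
  have "\<exists>t\<in>busy i. b \<le> t \<and> t < C i"
  proof (rule ccontr)
    \<comment> \<open>Otherwise the work done by \<open>C i\<close> would, up to the null set
      \<open>{C i}\<close>, already be done by \<open>b\<close>, before the \<alpha>-point is
      reached.\<close>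
    assume "\<not> ?thesis"
    then have "busy i \<inter> {0..C i} \<subseteq> (busy i \<inter> {0..b}) \<union> {C i}"
      by (auto simp: not_le intro: less_imp_le)
    then have "work i (C i) \<le> measure lborel ((busy i \<inter> {0..b}) \<union> {C i})"
      unfolding work_eq[OF i(1)] using i
      by (intro measure_mono_fmeasurable fmeasurable.Un fmeasurable_busy)
        (auto simp: fmeasurable_def)
    also have "\<dots> \<le> measure lborel (busy i \<inter> {0..b}) + measure lborel {C i}"
      using i by (intro measure_Un_le) auto
    also have "\<dots> < \<alpha> * q i"
      using work_before_alpha_point[OF i(1) \<alpha>, of b] i work_eq[OF i(1)] by (simp add: C_def)
    finally show False using work_alpha_point[OF i(1) \<alpha>] by (simp add: C_def)
  qed
  then obtain t where t: "t \<in> busy i" "b \<le> t" "t < C i" by blast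
  have "work j t < \<alpha> * q j"
    using t i work_before_alpha_point[OF jn \<alpha>] by (simp add: C_def)
  also have "\<dots> \<le> q j" using \<alpha> length_pos[OF jn] by simp
  finally have "t \<le> r j \<or> avail j t" by (auto simp: available_def)
  then obtain l where l: "l \<in> block k b" "t \<in> busy l"
    using block_covers[OF k j t(2)] by blast
  then have "l = i" using busy_unique[OF _ i(1)] t block_subset[OF k] by blast
  then show ?thesis using l by simp
qed

text \<open>By time \<open>b\<close> each of these jobs has received an \<alpha>-fraction of its
  length, and the machine offers only \<open>b\<close> units of time.\<close>

lemma sum_alpha_point_le:
  assumes \<alpha>: "0 < \<alpha>" "\<alpha> \<le> 1" and b: "0 \<le> b"
  shows "(\<Sum>i\<in>{i\<in>{1..n}. alpha_point q I \<alpha> i \<le> b}. q i) \<le> b / \<alpha>"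
proof -
  have "(\<Sum>i\<in>{i\<in>{1..n}. alpha_point q I \<alpha> i \<le> b}. \<alpha> * q i)
      \<le> (\<Sum>i\<in>{i\<in>{1..n}. alpha_point q I \<alpha> i \<le> b}. work i b)"
    using work_alpha_point[OF _ \<alpha>] work_mono by (intro sum_mono) fastforce
  also have "\<dots> \<le> b" using b by (intro sum_work_le) auto
  finally show ?thesis using \<alpha> by (simp add: sum_distrib_left[symmetric] field_simps)
qed

end

section \<open>The SOS policy\<close>

text \<open>A predecessor \<open>k\<close> of \<open>j\<close> and the predecessors of
  \<open>k\<close> are all predecessors of \<open>j\<close>, so the bound survives a step of the
  recursion.\<close>

lemma list_start_le:
  assumes "\<And>i. i \<in> {1..n} \<Longrightarrow> 0 \<le> x i"
  shows "list_start n C x j \<le> C j + (\<Sum>i\<in>{i\<in>{1..n}. C i < C j}. x i)"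
  using assms
proof (induction n C x j rule: list_start.induct)
  case (1 n C x j)
  have "list_start n C x k + x k \<le> C j + (\<Sum>i\<in>{i\<in>{1..n}. C i < C j}. x i)"
    if k: "k \<in> {1..n}" "C k < C j" for k
  proof -
    have "list_start n C x k + x k \<le> C k + (\<Sum>i\<in>insert k {i\<in>{1..n}. C i < C k}. x i)"
      using 1(1)[of k] 1(2) k by simp
    also have "\<dots> \<le> C j + (\<Sum>i\<in>{i\<in>{1..n}. C i < C j}. x i)"
      using k 1(2) by (intro add_mono sum_mono2) auto
    finally show ?thesis .
  qed
  moreover have "0 \<le> (\<Sum>i\<in>{i\<in>{1..n}. C i < C j}. x i)"
    using 1(2) by (intro sum_nonneg) auto
  ultimately show ?case by (subst list_start.simps) auto
qed

text \<open>The delay argument for one realisation, with \<open>S\<close> a block. Since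
  \<open>h\<close> bounds both the realised lengths and the increments of \<open>C\<close>, one sum
  of \<open>h\<close> covers waiting for \<open>C j\<close> as well as waiting for a
  predecessor.\<close>

lemma list_start_block_le:
  assumes "\<And>i. i \<in> {1..n} \<Longrightarrow> 0 \<le> x i" and "S \<subseteq> {1..n}" and "\<And>i. i \<in> S \<Longrightarrow> x i \<le> h i"
    and "\<And>j. j \<in> S \<Longrightarrow> C j \<le> b + D + (\<Sum>i\<in>{i\<in>S. C i < C j}. h i)"
    and "\<And>i j. j \<in> S \<Longrightarrow> i \<in> {1..n} \<Longrightarrow> C i < C j \<Longrightarrow> b < C i \<Longrightarrow> i \<in> S"
    and "0 \<le> D" and "j \<in> S"
  shows "list_start n C x j \<le> b + (\<Sum>i\<in>{i\<in>{1..n}. C i \<le> b}. x i) + D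
      + (\<Sum>i\<in>{i\<in>S. C i < C j}. h i)"
  using assms
proof (induction n C x j rule: list_start.induct)
  case (1 n C x j)
  let ?R = "\<Sum>i\<in>{i\<in>{1..n}. C i \<le> b}. x i" and ?H = "\<lambda>j. \<Sum>i\<in>{i\<in>S. C i < C j}. h i"
  have fin: "finite S" using 1(3) finite_subset by blast
  have h: "0 \<le> h i" if "i \<in> S" for i
    using 1(2)[of i] 1(3) 1(4)[OF that] that by force
  have R: "0 \<le> ?R" using 1(2) by (intro sum_nonneg) auto
  have H: "0 \<le> ?H j" using h by (intro sum_nonneg) auto
  have "list_start n C x k + x k \<le> b + ?R + D + ?H j"
    if k: "k \<in> {1..n}" "C k < C j" for k
  proof (cases "C k \<le> b")
    case True
    have "list_start n C x k + x k \<le> C k + (\<Sum>i\<in>insert k {i\<in>{1..n}. C i < C k}. x i)"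
      using list_start_le[of n x C k] 1(2) by simp
    also have "\<dots> \<le> b + ?R"
      using k True 1(2) by (intro add_mono sum_mono2) auto
    finally show ?thesis using H 1(7) by simp
  next
    case False
    \<comment> \<open>Closedness of \<open>S\<close> above \<open>b\<close> admits the induction
      hypothesis for \<open>k\<close>; \<open>x k \<le> h k\<close> then moves \<open>k\<close> into
      the sum for \<open>j\<close>.\<close>
    then have kS: "k \<in> S" using 1(6)[OF 1(8) k] by simp
    have "list_start n C x k \<le> b + ?R + D + ?H k"
      using 1(1)[of k] 1(2-7) k kS by blast
    then have "list_start n C x k + x k \<le> b + ?R + D + (\<Sum>i\<in>insert k {i\<in>S. C i < C k}. h i)"
      using 1(4)[OF kS] fin by simp
    also have "\<dots> \<le> b + ?R + D + ?H j"
      using k kS h fin by (intro add_mono sum_mono2) auto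
    finally show ?thesis .
  qed
  moreover have "C j \<le> b + ?R + D + ?H j" using 1(5)[OF 1(8)] R by simp
  ultimately show ?case by (subst list_start.simps) auto
qed

section \<open>Expected start times of SOS within a block\<close>

locale stochastic_WSPT_schedule = prob_space M + WSPT_schedule n r q I
  for M :: "'a measure" and n r q I +
  fixes p :: "nat \<Rightarrow> 'a \<Rightarrow> real" and \<Delta> :: real
  assumes indep: "indep_vars (\<lambda>_. borel) p {1..n}"
    and p_nonneg: "j \<in> {1..n} \<Longrightarrow> \<omega> \<in> space M \<Longrightarrow> 0 \<le> p j \<omega>"
    and p_integrable: "j \<in> {1..n} \<Longrightarrow> integrable M (p j)"
    and p_square_integrable: "j \<in> {1..n} \<Longrightarrow> integrable M (\<lambda>\<omega>. (p j \<omega>)\<^sup>2)"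
    and expectation_p: "j \<in> {1..n} \<Longrightarrow> expectation (p j) = q j"
    and CV2_le: "j \<in> {1..n} \<Longrightarrow> CV2 M (p j) \<le> \<Delta>"
begin

text \<open>The bound of \<open>list_start_block_le\<close> for the block of \<open>j\<close> in the
  prefix \<open>k\<close>. Its index sets are deterministic, so its expectation can be taken term by
  term.\<close>

definition SOS_start_bound :: "real \<Rightarrow> nat \<Rightarrow> nat \<Rightarrow> 'a \<Rightarrow> real" where
  "SOS_start_bound \<alpha> k j \<omega> =
     (let b = block_start k j; C = alpha_point q I \<alpha> in
      b + (\<Sum>i\<in>{i\<in>{1..n}. C i \<le> b}. p i \<omega>) + \<alpha> * (\<Sum>i\<in>block k b. q i)
        + (\<Sum>i\<in>{i\<in>block k b. C i < C j}. max (p i \<omega>) ((1 - \<alpha>) * q i)))"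

lemma SOS_le_bound:
  assumes k: "k \<le> n" and j: "j \<in> {1..k}" and \<alpha>: "0 < \<alpha>" "\<alpha> \<le> 1" and \<omega>: "\<omega> \<in> space M"
  shows "SOS n q I \<alpha> (realisation n p \<omega>) j \<le> SOS_start_bound \<alpha> k j \<omega>"
proof -
  define b where "b = block_start k j"
  define C where "C = alpha_point q I \<alpha>"
  let ?x = "realisation n p \<omega>" and ?B = "block k b" and ?P = "\<Sum>i\<in>block k b. q i"
  let ?h = "\<lambda>i. max (p i \<omega>) ((1 - \<alpha>) * q i)"
  have x: "?x i = p i \<omega>" if "i \<in> {1..n}" for i using that by (simp add: realisation_def)
  have B: "i \<in> {1..n}" if "i \<in> ?B" for i using block_subset[OF k] that by blast
  have jB: "j \<in> ?B" using j by (simp add: block_def b_def)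
  have P: "0 \<le> ?P" using B length_pos by (auto intro!: sum_nonneg intro: less_imp_le)
  have "list_start n C ?x j \<le> b + (\<Sum>i\<in>{i\<in>{1..n}. C i \<le> b}. ?x i) + \<alpha> * ?P
      + (\<Sum>i\<in>{i\<in>?B. C i < C j}. ?h i)"
  proof (rule list_start_block_le)
    show "0 \<le> ?x i" if "i \<in> {1..n}" for i using p_nonneg[OF that \<omega>] x[OF that] by simp
    show "?B \<subseteq> {1..n}" by (rule block_subset[OF k])
    show "?x i \<le> ?h i" if "i \<in> ?B" for i using x[OF B[OF that]] by simp
    show "C i \<le> b + \<alpha> * ?P + (\<Sum>l\<in>{l\<in>?B. C l < C i}. ?h l)" if "i \<in> ?B" for i
    proof -
      have "C i \<le> b + \<alpha> * ?P + (\<Sum>l\<in>{l\<in>?B. C l < C i}. (1 - \<alpha>) * q l)"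
        unfolding C_def by (rule block_alpha_point_le[OF k that \<alpha>])
      also have "\<dots> \<le> b + \<alpha> * ?P + (\<Sum>l\<in>{l\<in>?B. C l < C i}. ?h l)"
        by (intro add_left_mono sum_mono) simp
      finally show ?thesis .
    qed
    show "i \<in> ?B" if "l \<in> ?B" "i \<in> {1..n}" "C i < C l" "b < C i" for i l
      using block_alpha_point_closed[OF k that(1) \<alpha> that(2)] that(3,4) by (simp add: C_def)
  qed (use jB P \<alpha> in auto)
  also have "(\<Sum>i\<in>{i\<in>{1..n}. C i \<le> b}. ?x i) = (\<Sum>i\<in>{i\<in>{1..n}. C i \<le> b}. p i \<omega>)"
    using x by (intro sum.cong) auto
  finally show ?thesis
    by (simp add: SOS_def SOS_start_bound_def Let_def b_def C_def)
qed

lemma SOS_start_bound_integrable: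
  assumes "k \<le> n"
  shows "integrable M (SOS_start_bound \<alpha> k j)"
  unfolding SOS_start_bound_def Let_def
  using p_integrable subsetD[OF block_subset[OF assms]]
  by (intro Bochner_Integration.integrable_add Bochner_Integration.integrable_sum
      integrable_max) auto

lemma expectation_SOS_start_bound_le:
  fixes \<alpha> :: real
  defines "C \<equiv> alpha_point q I \<alpha>"
  assumes k: "k \<le> n" and j: "j \<in> block k b" and \<alpha>: "0 < \<alpha>" "\<alpha> \<le> 1"
  shows "expectation (SOS_start_bound \<alpha> k j) \<le> b + b / \<alpha> + \<alpha> * (\<Sum>i\<in>block k b. q i)
      + (1 + (1 - \<alpha>) * (1 - g \<Delta>)) * (\<Sum>i\<in>{i\<in>block k b. C i < C j}. q i)"
proof -
  let ?B = "block k b" and ?\<gamma> = "1 + (1 - \<alpha>) * (1 - g \<Delta>)"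
  have B: "i \<in> {1..n}" if "i \<in> ?B" for i using block_subset[OF k] that by blast
  have b: "block_start k j = b" using j by (simp add: block_def)
  have int_max: "integrable M (\<lambda>\<omega>. max (p i \<omega>) ((1 - \<alpha>) * q i))" if "i \<in> ?B" for i
    using p_integrable[OF B[OF that]] by (intro integrable_max) auto
  have "expectation (SOS_start_bound \<alpha> k j)
      = b + (\<Sum>i\<in>{i\<in>{1..n}. C i \<le> b}. q i) + \<alpha> * (\<Sum>i\<in>?B. q i)
        + (\<Sum>i\<in>{i\<in>?B. C i < C j}. expectation (\<lambda>\<omega>. max (p i \<omega>) ((1 - \<alpha>) * q i)))"
  proof -
    let ?R = "\<lambda>\<omega>. \<Sum>i\<in>{i\<in>{1..n}. C i \<le> b}. p i \<omega>"
    let ?H = "\<lambda>\<omega>. \<Sum>i\<in>{i\<in>?B. C i < C j}. max (p i \<omega>) ((1 - \<alpha>) * q i)"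
    have R: "integrable M ?R" "expectation ?R = (\<Sum>i\<in>{i\<in>{1..n}. C i \<le> b}. q i)"
      using p_integrable expectation_p
      by (auto intro!: Bochner_Integration.integrable_sum sum.cong
          simp: Bochner_Integration.integral_sum)
    have H: "integrable M ?H" "expectation ?H
        = (\<Sum>i\<in>{i\<in>?B. C i < C j}. expectation (\<lambda>\<omega>. max (p i \<omega>) ((1 - \<alpha>) * q i)))"
      using int_max
      by (auto intro!: Bochner_Integration.integrable_sum Bochner_Integration.integral_sum)
    have "SOS_start_bound \<alpha> k j = (\<lambda>\<omega>. b + ?R \<omega> + \<alpha> * (\<Sum>i\<in>?B. q i) + ?H \<omega>)"
      by (simp add: fun_eq_iff SOS_start_bound_def Let_def b C_def)
    then show ?thesis using R H by (simp add: prob_space del: Bochner_Integration.integral_sum)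
  qed
  also have "\<dots> \<le> b + b / \<alpha> + \<alpha> * (\<Sum>i\<in>?B. q i) + (\<Sum>i\<in>{i\<in>?B. C i < C j}. ?\<gamma> * q i)"
  proof (intro add_mono sum_mono order_refl)
    show "(\<Sum>i\<in>{i\<in>{1..n}. C i \<le> b}. q i) \<le> b / \<alpha>"
      unfolding C_def using block_release[OF k j] by (intro sum_alpha_point_le[OF \<alpha>])
    fix i assume "i \<in> {i\<in>?B. C i < C j}"
    then have i: "i \<in> {1..n}" using B by blast
    show "expectation (\<lambda>\<omega>. max (p i \<omega>) ((1 - \<alpha>) * q i)) \<le> ?\<gamma> * q i"
      using \<alpha> by (intro expectation_max_le p_integrable p_square_integrable p_nonneg
          expectation_p CV2_le length_pos i) auto
  qed
  finally show ?thesis by (simp add: sum_distrib_left)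
qed

text \<open>Summation leaves multiples of \<open>b * P\<close> and of \<open>P\<^sup>2 / 2\<close>,
  and \<open>c\<close> is the larger of the two factors; the preemptive block contributes
  \<open>b * P + P\<^sup>2 / 2\<close>.\<close>

lemma block_SOS_bound_le:
  fixes \<alpha> :: real
  defines "c \<equiv> 1 + max (1 / \<alpha>) (1 + \<alpha> - g \<Delta> * (1 - \<alpha>))"
  assumes k: "k \<le> n" and \<alpha>: "0 < \<alpha>" "\<alpha> \<le> 1"
  shows "(\<Sum>j\<in>block k b. q j * (expectation (SOS_start_bound \<alpha> k j) + q j / 2))
      \<le> c * (\<Sum>j\<in>block k b. q j * preemptive_mean_busy_date q I j)"
proof (cases "block k b = {}")
  case False
  let ?B = "block k b"
  define C where "C = alpha_point q I \<alpha>"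
  define P where "P = (\<Sum>i\<in>?B. q i)"
  define \<gamma> where "\<gamma> = 1 + (1 - \<alpha>) * (1 - g \<Delta>)"
  define X where "X = (\<Sum>j\<in>?B. q j * (\<Sum>i\<in>{i\<in>?B. C i < C j}. q i))"
  define V where "V = (\<Sum>j\<in>?B. (q j)\<^sup>2)"
  have fin: "finite ?B" by (simp add: block_def)
  have B: "i \<in> {1..n}" if "i \<in> ?B" for i using block_subset[OF k] that by blast
  have q: "0 < q i" if "i \<in> ?B" for i using length_pos[OF B[OF that]] .
  obtain j where j: "j \<in> ?B" using False by blast
  have b: "0 \<le> b" using block_release[OF k j] by simp
  have "0 \<le> \<Delta>" using CV2_nonneg[of "p j"] CV2_le[OF B[OF j]] by linarith
  then have \<gamma>: "1 \<le> \<gamma>" using \<alpha> g_le_1 by (simp add: \<gamma>_def)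
  have P: "0 \<le> P" unfolding P_def using q by (auto intro!: sum_nonneg intro: less_imp_le)
  have XV: "2 * X + V \<le> P\<^sup>2"
    unfolding X_def V_def P_def using fin q
    by (intro square_sum_by_order_ge) (auto intro: less_imp_le)
  have V: "0 \<le> V" unfolding V_def by (intro sum_nonneg) auto
  have "(\<Sum>j\<in>?B. q j * (expectation (SOS_start_bound \<alpha> k j) + q j / 2))
      \<le> (\<Sum>j\<in>?B. q j * (b + b / \<alpha> + \<alpha> * P + \<gamma> * (\<Sum>i\<in>{i\<in>?B. C i < C j}. q i) + q j / 2))"
    using expectation_SOS_start_bound_le[OF k _ \<alpha>] q
    by (intro sum_mono mult_left_mono add_right_mono)
      (auto simp: P_def \<gamma>_def C_def intro: less_imp_le)
  also have "\<dots> = (\<Sum>j\<in>?B. q j * (b + b / \<alpha> + \<alpha> * P)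
      + \<gamma> * (q j * (\<Sum>i\<in>{i\<in>?B. C i < C j}. q i)) + (q j)\<^sup>2 / 2)"
    by (intro sum.cong) (auto simp: algebra_simps power2_eq_square)
  also have "\<dots> = P * (b + b / \<alpha> + \<alpha> * P) + \<gamma> * X + V / 2"
    by (simp add: sum.distrib P_def X_def V_def sum_distrib_left sum_distrib_right
        sum_divide_distrib)
  \<comment> \<open>Since \<open>\<gamma> \<ge> 1\<close>, the diagonal \<open>V / 2\<close> may be
    enlarged to \<open>\<gamma> * (V / 2)\<close>, which cancels the \<open>V\<close> left by
    \<open>XV\<close>.\<close>
  also have "\<dots> \<le> P * (b + b / \<alpha> + \<alpha> * P) + \<gamma> * ((P\<^sup>2 - V) / 2) + \<gamma> * (V / 2)"
    using XV \<gamma> V mult_right_mono[OF \<gamma>, of "V / 2"]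
    by (intro add_mono mult_left_mono order_refl) auto
  also have "\<dots> = (1 + 1 / \<alpha>) * (b * P) + (2 + \<alpha> - g \<Delta> * (1 - \<alpha>)) * (P\<^sup>2 / 2)"
    using \<alpha> by (simp add: \<gamma>_def field_simps power2_eq_square)
  also have "\<dots> \<le> c * (b * P) + c * (P\<^sup>2 / 2)"
    using b P by (intro add_mono mult_right_mono) (auto simp: c_def)
  also have "\<dots> = c * (\<Sum>j\<in>?B. q j * preemptive_mean_busy_date q I j)"
    by (subst block_mean_busy_date[OF k P_def]) (simp add: algebra_simps)
  finally show ?thesis .
qed simp

section \<open>From blocks to the weighted objective\<close>

lemma sum_blocks: "(\<Sum>j=1..k. f j) = (\<Sum>b\<in>block_start k ` {1..k}. \<Sum>j\<in>block k b. f j)"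
  unfolding block_def by (rule sum.image_gen) simp

text \<open>The start bound of a job varies with the prefix, so the objective is split into prefixes
  inside the expectation; each prefix is then a sum over blocks.\<close>

lemma expected_SOS_le:
  fixes \<alpha> :: real and w :: "nat \<Rightarrow> real"
  defines "c \<equiv> 1 + max (1 / \<alpha>) (1 + \<alpha> - g \<Delta> * (1 - \<alpha>))"
  assumes \<alpha>: "0 < \<alpha>" "\<alpha> \<le> 1" and w: "\<And>j. j \<in> {1..n} \<Longrightarrow> 0 \<le> w j"
    and ratio: "\<And>i j. i \<in> {1..n} \<Longrightarrow> j \<in> {1..n} \<Longrightarrow> i \<le> j \<Longrightarrow> w j / q j \<le> w i / q i"
  shows "expected_weighted_mean_busy M n w p (SOS n q I \<alpha>)
      \<le> ennreal (c * (\<Sum>j=1..n. w j * preemptive_mean_busy_date q I j))"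
proof -
  from weighted_sum_prefix_decomposition[OF w length_pos ratio]
  obtain \<delta> where *: "(\<forall>k\<in>{1..n}. 0 \<le> \<delta> k) \<and>
    (\<forall>a. (\<Sum>j=1..n. w j * a j) = (\<Sum>k=1..n. \<delta> k * (\<Sum>j=1..k. q j * a j)))"
    by (rule exE)
  note \<delta> = conjunct1[OF *, rule_format] and dec = conjunct2[OF *, rule_format]
  let ?U = "\<lambda>k j \<omega>. SOS_start_bound \<alpha> k j \<omega> + p j \<omega> / 2"
  let ?F = "\<lambda>\<omega>. \<Sum>k=1..n. \<delta> k * (\<Sum>j=1..k. q j * ?U k j \<omega>)"
  let ?m = "\<lambda>\<omega>. mean_busy_date (SOS n q I \<alpha>) (realisation n p \<omega>)"
  have SOS_nonneg: "0 \<le> SOS n q I \<alpha> x j" if "j \<in> {1..n}" for x j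
  proof -
    have "alpha_point q I \<alpha> j \<le> SOS n q I \<alpha> x j"
      unfolding SOS_def by (subst list_start.simps) (intro Max_ge, auto)
    then show ?thesis using alpha_point_nonneg[OF that \<alpha>] by linarith
  qed
  have m_le: "?m \<omega> j \<le> ?U k j \<omega>" if "k \<in> {1..n}" "j \<in> {1..k}" "\<omega> \<in> space M" for k j \<omega>
    using SOS_le_bound[of k j \<alpha> \<omega>] that \<alpha>
    by (simp add: mean_busy_date_def completion_time_def realisation_def)
  have m_nonneg: "0 \<le> ?m \<omega> j" if "j \<in> {1..n}" "\<omega> \<in> space M" for j \<omega>
    using SOS_nonneg[OF that(1)] p_nonneg[OF that] that(1)
    by (simp add: mean_busy_date_def completion_time_def realisation_def)
  have int: "integrable M (?U k j)" if "k \<in> {1..n}" "j \<in> {1..k}" for k j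
  proof -
    have "j \<in> {1..n}" "k \<le> n" using that by auto
    then show ?thesis using p_integrable[of j] SOS_start_bound_integrable[of k \<alpha> j] by simp
  qed
  have EU: "expectation (?U k j) = expectation (SOS_start_bound \<alpha> k j) + q j / 2"
    if "k \<in> {1..n}" "j \<in> {1..k}" for k j
  proof -
    have "j \<in> {1..n}" "k \<le> n" using that by auto
    then show ?thesis
      using p_integrable[of j] expectation_p[of j] SOS_start_bound_integrable[of k \<alpha> j] by simp
  qed
  have le: "(\<Sum>j=1..n. w j * ?m \<omega> j) \<le> ?F \<omega>" if "\<omega> \<in> space M" for \<omega>
    unfolding dec using that length_pos
    by (intro sum_mono mult_left_mono m_le \<delta>) (auto intro: less_imp_le)
  have nonneg: "0 \<le> ?F \<omega>" if "\<omega> \<in> space M" for \<omega>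
  proof -
    have "0 \<le> (\<Sum>j=1..n. w j * ?m \<omega> j)"
      using w m_nonneg[OF _ that] by (intro sum_nonneg mult_nonneg_nonneg) auto
    then show ?thesis using le[OF that] by linarith
  qed
  have F: "integrable M ?F"
    using int by (intro Bochner_Integration.integrable_sum integrable_mult_right) auto
  have "expected_weighted_mean_busy M n w p (SOS n q I \<alpha>) \<le> (\<integral>\<^sup>+\<omega>. ennreal (?F \<omega>) \<partial>M)"
    unfolding expected_weighted_mean_busy_def using le by (intro nn_integral_mono ennreal_leI)
  also have "\<dots> = ennreal (expectation ?F)"
    using F nonneg by (intro nn_integral_eq_integral) auto
  also have "expectation ?F
      = (\<Sum>k=1..n. \<delta> k * (\<Sum>j=1..k. q j * (expectation (SOS_start_bound \<alpha> k j) + q j / 2)))"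
  proof -
    have "expectation ?F = (\<Sum>k=1..n. expectation (\<lambda>\<omega>. \<delta> k * (\<Sum>j=1..k. q j * ?U k j \<omega>)))"
      using int by (intro Bochner_Integration.integral_sum integrable_mult_right
          Bochner_Integration.integrable_sum) auto
    also have "\<dots> = (\<Sum>k=1..n. \<delta> k * (\<Sum>j=1..k. q j * expectation (?U k j)))"
    proof (rule sum.cong[OF refl])
      fix k assume k: "k \<in> {1..n}"
      have "expectation (\<lambda>\<omega>. \<Sum>j=1..k. q j * ?U k j \<omega>) = (\<Sum>j=1..k. expectation (\<lambda>\<omega>. q j * ?U k j \<omega>))"
        using int[OF k] by (intro Bochner_Integration.integral_sum integrable_mult_right) auto
      then show "expectation (\<lambda>\<omega>. \<delta> k * (\<Sum>j=1..k. q j * ?U k j \<omega>))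
          = \<delta> k * (\<Sum>j=1..k. q j * expectation (?U k j))" by simp
    qed
    also have "\<dots> = (\<Sum>k=1..n. \<delta> k * (\<Sum>j=1..k. q j * (expectation (SOS_start_bound \<alpha> k j) + q j / 2)))"
      by (rule sum.cong[OF refl], intro arg_cong2[where f = "(*)"] refl sum.cong) (rule EU, auto)
    finally show ?thesis .
  qed
  also have "ennreal \<dots> \<le> ennreal (c * (\<Sum>j=1..n. w j * preemptive_mean_busy_date q I j))"
  proof (rule ennreal_leI)
    have "(\<Sum>j=1..k. q j * (expectation (SOS_start_bound \<alpha> k j) + q j / 2))
        \<le> c * (\<Sum>j=1..k. q j * preemptive_mean_busy_date q I j)" if "k \<in> {1..n}" for k
      unfolding sum_blocks c_def using that \<alpha>
      by (subst sum_distrib_left) (intro sum_mono block_SOS_bound_le, auto)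
    then have "(\<Sum>k=1..n. \<delta> k * (\<Sum>j=1..k. q j * (expectation (SOS_start_bound \<alpha> k j) + q j / 2)))
        \<le> (\<Sum>k=1..n. \<delta> k * (c * (\<Sum>j=1..k. q j * preemptive_mean_busy_date q I j)))"
      using \<delta> by (intro sum_mono mult_left_mono) auto
    also have "\<dots> = c * (\<Sum>j=1..n. w j * preemptive_mean_busy_date q I j)"
      unfolding dec by (simp add: sum_distrib_left mult.left_commute)
    finally show "(\<Sum>k=1..n. \<delta> k * (\<Sum>j=1..k. q j * (expectation (SOS_start_bound \<alpha> k j) + q j / 2)))
        \<le> c * (\<Sum>j=1..n. w j * preemptive_mean_busy_date q I j)" .
  qed
  finally show ?thesis .
qed

end

section \<open>Arbitrary policies\<close>

text \<open>The histories under \<open>x\<close> and \<open>y\<close> agree until \<open>j\<close>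
  is selected, since no earlier entry records the length of \<open>j\<close>. Both runs thus select
  \<open>j\<close> at the same step with the same start.\<close>

lemma scheduling_policy_nonanticipative:
  assumes \<pi>: "scheduling_policy n r \<pi>" and j: "j \<in> {1..n}"
    and x: "x \<in> {1..n} \<rightarrow>\<^sub>E {0..}" and y: "y \<in> {1..n} \<rightarrow>\<^sub>E {0..}"
    and eq: "\<And>i. i \<noteq> j \<Longrightarrow> x i = y i"
  shows "\<pi> x j = \<pi> y j"
proof -
  from \<pi> obtain d where "\<forall>x \<in> {1..n} \<rightarrow>\<^sub>E {0..}. bij_betw (next_job d x) {..<n} {1..n} \<and>
      (\<forall>i<n. \<pi> x (next_job d x i) = next_start d x i \<and> r (next_job d x i) \<le> next_start d x i \<and>
        (\<forall>l<i. completion_time \<pi> x (next_job d x l) \<le> next_start d x i))"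
    unfolding scheduling_policy_def by (elim conjE exE)
  then have d: "bij_betw (next_job d x) {..<n} {1..n}"
      "i < n \<Longrightarrow> \<pi> x (next_job d x i) = next_start d x i"
    if "x \<in> {1..n} \<rightarrow>\<^sub>E {0..}" for x i
    using that by simp_all
  have "j \<in> next_job d x ` {..<n}" using d(1)[OF x] j unfolding bij_betw_def by simp
  then obtain i where i: "i < n" "next_job d x i = j" by blast
  have hist: "history d x l = history d y l" if "l \<le> i" for l
    using that
  proof (induction l)
    case (Suc l)
    have "next_job d x l \<noteq> j"
    proof
      assume "next_job d x l = j"
      moreover have "inj_on (next_job d x) {..<n}" using d(1)[OF x] by (rule bij_betw_imp_inj_on)
      ultimately have "l = i" using i Suc.prems by (auto dest: inj_onD)
      then show False using Suc.prems by simp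
    qed
    then show ?case using Suc eq by (auto simp: next_job_def case_prod_beta Let_def)
  qed simp
  then have "next_job d y i = j" "next_start d x i = next_start d y i"
    using i(2) by (simp_all add: next_job_def next_start_def)
  then show ?thesis using d(2)[OF x i(1)] d(2)[OF y i(1)] i by simp
qed

lemma scheduling_policy_release:
  assumes \<pi>: "scheduling_policy n r \<pi>" and x: "x \<in> {1..n} \<rightarrow>\<^sub>E {0..}" and j: "j \<in> {1..n}"
  shows "r j \<le> \<pi> x j"
proof -
  obtain d where d: "bij_betw (next_job d x) {..<n} {1..n}"
      "\<And>i. i < n \<Longrightarrow> \<pi> x (next_job d x i) = next_start d x i \<and> r (next_job d x i) \<le> next_start d x i"
    using \<pi> x unfolding scheduling_policy_def by blast
  have "j \<in> next_job d x ` {..<n}" using d(1) j unfolding bij_betw_def by simp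
  then obtain i where "i < n" "next_job d x i = j" by blast
  then show ?thesis using d(2) by metis
qed

text \<open>In the order of selection each job of \<open>S\<close> starts no earlier than
  \<open>b\<close> plus the lengths of its predecessors in \<open>S\<close>. The statement uses the
  index order because, unlike the selection order, it does not vary with \<open>x\<close>.\<close>

lemma scheduling_policy_weighted_start_ge:
  assumes \<pi>: "scheduling_policy n r \<pi>" and x: "x \<in> {1..n} \<rightarrow>\<^sub>E {0..}"
    and S: "S \<subseteq> {1..n}" and b: "\<And>j. j \<in> S \<Longrightarrow> b \<le> r j"
  shows "b * (\<Sum>j\<in>S. x j) + (\<Sum>j\<in>S. x j * (\<Sum>i\<in>{i\<in>S. i < j}. x i)) \<le> (\<Sum>j\<in>S. x j * \<pi> x j)"
proof -
  obtain d where bij: "bij_betw (next_job d x) {..<n} {1..n}"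
    and d: "\<And>i l. i < n \<Longrightarrow> \<pi> x (next_job d x i) = next_start d x i \<and>
      (l < i \<longrightarrow> completion_time \<pi> x (next_job d x l) \<le> next_start d x i)"
    using \<pi> x unfolding scheduling_policy_def by blast
  define pos where "pos = the_inv_into {..<n} (next_job d x)"
  have pos: "pos j < n" "next_job d x (pos j) = j" if "j \<in> {1..n}" for j
    using bij that the_inv_into_into[of "next_job d x" "{..<n}" j "{..<n}"]
      f_the_inv_into_f[of "next_job d x" "{..<n}" j]
    by (auto simp: bij_betw_def pos_def)
  have inj: "inj_on pos S" by (rule inj_on_inverseI[of _ "next_job d x"]) (use pos S in auto)
  have fin: "finite S" using S finite_subset by blast
  have x0: "0 \<le> x j" if "j \<in> S" for j using x S that by (auto simp: PiE_iff)
  have after: "\<pi> x i + x i \<le> \<pi> x j" if "i \<in> S" "j \<in> S" "pos i < pos j" for i j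
  proof -
    have "i \<in> {1..n}" "j \<in> {1..n}" using that S by blast+
    then show ?thesis
      using d[OF pos(1), of j "pos i"] pos(2)[of i] pos(2)[of j] that(3)
      by (simp add: completion_time_def)
  qed
  have start: "b + (\<Sum>i\<in>{i\<in>S. pos i < pos j}. x i) \<le> \<pi> x j" if "j \<in> S" for j
    using that
  proof (induction "pos j" arbitrary: j rule: less_induct)
    case less
    let ?T = "{i\<in>S. pos i < pos j}"
    show ?case
    proof (cases "?T = {}")
      case True
      have "b \<le> \<pi> x j"
        using b[OF less.prems] scheduling_policy_release[OF \<pi> x, of j] less.prems S by force
      then show ?thesis unfolding True by simp
    next
      case False
      define m where "m = Max (pos ` ?T)"
      have "m \<in> pos ` ?T" unfolding m_def using False fin by (intro Max_in) auto
      then obtain i where i: "i \<in> S" "pos i < pos j" "m = pos i" by blast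
      have max: "pos l \<le> pos i" if "l \<in> ?T" for l
        unfolding i(3)[symmetric] m_def using that fin by (intro Max_ge) auto
      have "?T = insert i {l\<in>S. pos l < pos i}"
        using i max inj by (auto simp: le_less dest: inj_onD)
      then have "(\<Sum>l\<in>?T. x l) = x i + (\<Sum>l\<in>{l\<in>S. pos l < pos i}. x l)"
        using fin by simp
      then show ?thesis using less.hyps[OF i(2,1)] after[OF i(1) less.prems i(2)] by simp
    qed
  qed
  \<comment> \<open>Selection order and index order give the same sum, as both are determined by the
    square of the total.\<close>
  have "(\<Sum>j\<in>S. x j * (\<Sum>i\<in>{i\<in>S. i < j}. x i)) = (\<Sum>j\<in>S. x j * (\<Sum>i\<in>{i\<in>S. pos i < pos j}. x i))"
    using square_sum_by_order_inj[OF fin inj, of x]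
      square_sum_by_order_inj[OF fin inj_on_id2, of x] by simp
  then have "b * (\<Sum>j\<in>S. x j) + (\<Sum>j\<in>S. x j * (\<Sum>i\<in>{i\<in>S. i < j}. x i))
      = (\<Sum>j\<in>S. x j * (b + (\<Sum>i\<in>{i\<in>S. pos i < pos j}. x i)))"
    by (simp add: sum_distrib_left distrib_left sum.distrib mult.commute)
  also have "\<dots> \<le> (\<Sum>j\<in>S. x j * \<pi> x j)"
    using start x0 by (intro sum_mono mult_left_mono)
  finally show ?thesis .
qed

section \<open>Expected cost of a policy\<close>

context stochastic_WSPT_schedule begin

lemma p_measurable: "j \<in> {1..n} \<Longrightarrow> p j \<in> borel_measurable M"
  using p_integrable by auto

lemma realisation_PiE: "\<omega> \<in> space M \<Longrightarrow> realisation n p \<omega> \<in> {1..n} \<rightarrow>\<^sub>E {0..}"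
  using p_nonneg by (auto simp: realisation_def)

lemma indep_p:
  assumes "i \<in> {1..n}" "j \<in> {1..n}" "i \<noteq> j"
  shows "indep_var borel (p i) borel (p j)"
proof -
  have "indep_var borel ((\<lambda>y. y i) \<circ> (\<lambda>\<omega>. \<lambda>l\<in>{i}. p l \<omega>)) borel ((\<lambda>y. y j) \<circ> (\<lambda>\<omega>. \<lambda>l\<in>{j}. p l \<omega>))"
    using assms by (intro indep_var_compose[OF indep_var_restrict[OF indep]]) auto
  then show ?thesis by (simp add: comp_def)
qed

lemma policy_start_measurable:
  assumes \<pi>: "scheduling_policy n r \<pi>" and j: "j \<in> {1..n}"
  shows "(\<lambda>\<omega>. \<pi> (realisation n p \<omega>) j) \<in> borel_measurable M"
proof -
  have "realisation n p \<in> M \<rightarrow>\<^sub>M (\<Pi>\<^sub>M i\<in>{1..n}. restrict_space borel {0..})"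
    unfolding realisation_def
    using p_measurable p_nonneg by (intro measurable_restrict measurable_restrict_space2) auto
  moreover have "(\<lambda>x. \<pi> x j) \<in> borel_measurable (\<Pi>\<^sub>M i\<in>{1..n}. restrict_space borel {0..})"
    using \<pi> j by (simp add: scheduling_policy_def)
  ultimately show ?thesis by (rule measurable_compose)
qed

text \<open>By non-anticipation the start of \<open>j\<close> is unchanged when the length of
  \<open>j\<close> is overwritten. It is thus a function of the other lengths, which are independent
  of \<open>p j\<close>.\<close>

lemma indep_policy_start:
  assumes \<pi>: "scheduling_policy n r \<pi>" and j: "j \<in> {1..n}"
  shows "indep_var borel (p j) borel (\<lambda>\<omega>. \<pi> (realisation n p \<omega>) j)"
proof -
  \<comment> \<open>The length of \<open>j\<close> becomes 0, an admissible value;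
    \<open>max 0\<close> turns every vector into an admissible realisation, so that the composition
    is measurable.\<close>
  define reset where "reset y = (\<lambda>i\<in>{1..n}. if i = j then 0 else max 0 (y i))" for y :: "nat \<Rightarrow> real"
  let ?A = "{1..n} - {j}"
  have "reset \<in> (\<Pi>\<^sub>M i\<in>?A. borel) \<rightarrow>\<^sub>M (\<Pi>\<^sub>M i\<in>{1..n}. restrict_space borel {0..})"
    unfolding reset_def
  proof (intro measurable_restrict measurable_restrict_space2)
    fix i assume "i \<in> {1..n}"
    then have "(\<lambda>y. y i :: real) \<in> borel_measurable (\<Pi>\<^sub>M i\<in>?A. borel)" if "i \<noteq> j"
      using that by (intro measurable_component_singleton) auto
    then show "(\<lambda>y. if i = j then 0 else max 0 (y i) :: real) \<in> borel_measurable (\<Pi>\<^sub>M i\<in>?A. borel)"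
      by (cases "i = j") (auto intro: borel_measurable_max)
  qed auto
  moreover have "(\<lambda>x. \<pi> x j) \<in> borel_measurable (\<Pi>\<^sub>M i\<in>{1..n}. restrict_space borel {0..})"
    using \<pi> j by (simp add: scheduling_policy_def)
  ultimately have meas: "(\<lambda>y. \<pi> (reset y) j) \<in> borel_measurable (\<Pi>\<^sub>M i\<in>?A. borel)"
    by (rule measurable_compose)
  have "indep_var borel ((\<lambda>y. y j) \<circ> (\<lambda>\<omega>. \<lambda>l\<in>{j}. p l \<omega>))
      borel ((\<lambda>y. \<pi> (reset y) j) \<circ> (\<lambda>\<omega>. \<lambda>l\<in>?A. p l \<omega>))"
    using j meas by (intro indep_var_compose[OF indep_var_restrict[OF indep]]) auto
  then have ind: "indep_var borel (p j) borel (\<lambda>\<omega>. \<pi> (reset (\<lambda>l\<in>?A. p l \<omega>)) j)"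
    by (simp add: comp_def)
  have same: "\<pi> (reset (\<lambda>l\<in>?A. p l \<omega>)) j = \<pi> (realisation n p \<omega>) j" if "\<omega> \<in> space M" for \<omega>
  proof (rule scheduling_policy_nonanticipative[OF \<pi> j])
    show "realisation n p \<omega> \<in> {1..n} \<rightarrow>\<^sub>E {0..}" by (rule realisation_PiE[OF that])
    show "reset (\<lambda>l\<in>?A. p l \<omega>) \<in> {1..n} \<rightarrow>\<^sub>E {0..}" by (auto simp: reset_def)
    show "reset (\<lambda>l\<in>?A. p l \<omega>) i = realisation n p \<omega> i" if "i \<noteq> j" for i
      using that p_nonneg[OF _ \<open>\<omega> \<in> space M\<close>, of i] by (auto simp: reset_def realisation_def)
  qed
  have "(\<lambda>\<omega>. \<pi> (reset (\<lambda>l\<in>?A. p l \<omega>)) j) -` X \<inter> space M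
      = (\<lambda>\<omega>. \<pi> (realisation n p \<omega>) j) -` X \<inter> space M" for X
    using same by auto
  then show ?thesis
    using ind policy_start_measurable[OF \<pi> j] unfolding indep_var_eq by simp
qed

text \<open>With integrable start times, \<open>scheduling_policy_weighted_start_ge\<close> is
  integrated, and independence turns products into products of means. Otherwise the right-hand side
  is infinite.\<close>

lemma block_policy_ge:
  assumes k: "k \<le> n" and \<pi>: "scheduling_policy n r \<pi>"
  shows "ennreal (\<Sum>j\<in>block k b. q j * preemptive_mean_busy_date q I j)
      \<le> (\<integral>\<^sup>+\<omega>. ennreal (\<Sum>j\<in>block k b. q j * mean_busy_date \<pi> (realisation n p \<omega>) j) \<partial>M)"
proof -
  let ?B = "block k b"
  define P where "P = (\<Sum>i\<in>?B. q i)"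
  define s where "s j \<omega> = \<pi> (realisation n p \<omega>) j" for j \<omega>
  have fin: "finite ?B" by (simp add: block_def)
  have B: "j \<in> {1..n}" if "j \<in> ?B" for j using block_subset[OF k] that by blast
  have q: "0 < q j" if "j \<in> ?B" for j using length_pos[OF B[OF that]] .
  have s_meas: "s j \<in> borel_measurable M" if "j \<in> ?B" for j
    unfolding s_def using policy_start_measurable[OF \<pi> B[OF that]] .
  have s_nonneg: "0 \<le> s j \<omega>" if "j \<in> ?B" "\<omega> \<in> space M" for j \<omega>
    using scheduling_policy_release[OF \<pi> realisation_PiE[OF that(2)] B[OF that(1)]]
      release_nonneg[OF B[OF that(1)]] by (simp add: s_def)
  have m: "mean_busy_date \<pi> (realisation n p \<omega>) j = s j \<omega> + p j \<omega> / 2" if "j \<in> ?B" for j \<omega>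
    using B[OF that] by (simp add: mean_busy_date_def completion_time_def s_def realisation_def)
  have m_sum: "(\<Sum>j\<in>?B. q j * mean_busy_date \<pi> (realisation n p \<omega>) j)
      = (\<Sum>j\<in>?B. q j * (s j \<omega> + p j \<omega> / 2))" for \<omega>
    using m by (intro sum.cong) auto
  have term_nonneg: "0 \<le> q j * (s j \<omega> + p j \<omega> / 2)" if "j \<in> ?B" "\<omega> \<in> space M" for j \<omega>
    using q[OF that(1)] s_nonneg[OF that] p_nonneg[OF B[OF that(1)] that(2)] by simp
  show ?thesis
  proof (cases "\<forall>j\<in>?B. integrable M (s j)")
    case True
    have p: "integrable M (p j)" "expectation (p j) = q j" if "j \<in> ?B" for j
      using p_integrable expectation_p B[OF that] by auto
    \<comment> \<open>In expectation the realised weight \<open>p j\<close> of the start time may be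
      replaced by \<open>q j\<close>.\<close>
    have ps: "integrable M (\<lambda>\<omega>. p j \<omega> * s j \<omega>)"
      "expectation (\<lambda>\<omega>. p j \<omega> * s j \<omega>) = q j * expectation (s j)" if "j \<in> ?B" for j
      using indep_var_integrable[OF indep_policy_start[OF \<pi> B[OF that]]]
        indep_var_lebesgue_integral[OF indep_policy_start[OF \<pi> B[OF that]]]
        p[OF that] True that unfolding s_def by auto
    have pp: "integrable M (\<lambda>\<omega>. p j \<omega> * p i \<omega>)"
      "expectation (\<lambda>\<omega>. p j \<omega> * p i \<omega>) = q j * q i" if "j \<in> ?B" "i \<in> ?B" "i < j" for i j
      using indep_var_integrable[OF indep_p[of j i]] indep_var_lebesgue_integral[OF indep_p[of j i]]
        B p that by auto
    let ?L = "\<lambda>\<omega>. b * (\<Sum>j\<in>?B. p j \<omega>) + (\<Sum>j\<in>?B. \<Sum>i\<in>{i\<in>?B. i < j}. p j \<omega> * p i \<omega>)"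
    let ?R = "\<lambda>\<omega>. \<Sum>j\<in>?B. p j \<omega> * s j \<omega>"
    have "?L \<omega> \<le> ?R \<omega>" if "\<omega> \<in> space M" for \<omega>
    proof -
      have eq: "realisation n p \<omega> j = p j \<omega>" if "j \<in> ?B" for j
        using B[OF that] by (simp add: realisation_def)
      have "b * (\<Sum>j\<in>?B. realisation n p \<omega> j)
          + (\<Sum>j\<in>?B. realisation n p \<omega> j * (\<Sum>i\<in>{i\<in>?B. i < j}. realisation n p \<omega> i))
          \<le> (\<Sum>j\<in>?B. realisation n p \<omega> j * \<pi> (realisation n p \<omega>) j)"
        by (rule scheduling_policy_weighted_start_ge[OF \<pi> realisation_PiE[OF that] block_subset[OF k]
              block_release(2)[OF k]])
      then show ?thesis by (simp add: eq s_def sum_distrib_left)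
    qed
    moreover have L: "integrable M ?L" "expectation ?L = b * P + (\<Sum>j\<in>?B. \<Sum>i\<in>{i\<in>?B. i < j}. q j * q i)"
    proof -
      have 1: "integrable M (\<lambda>\<omega>. \<Sum>j\<in>?B. p j \<omega>)" "expectation (\<lambda>\<omega>. \<Sum>j\<in>?B. p j \<omega>) = P"
        using p by (auto simp: Bochner_Integration.integral_sum P_def)
      have 2: "integrable M (\<lambda>\<omega>. \<Sum>i\<in>{i\<in>?B. i < j}. p j \<omega> * p i \<omega>)"
        "expectation (\<lambda>\<omega>. \<Sum>i\<in>{i\<in>?B. i < j}. p j \<omega> * p i \<omega>) = (\<Sum>i\<in>{i\<in>?B. i < j}. q j * q i)"
        if "j \<in> ?B" for j
        using pp that by (auto simp: Bochner_Integration.integral_sum)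
      have 3: "integrable M (\<lambda>\<omega>. \<Sum>j\<in>?B. \<Sum>i\<in>{i\<in>?B. i < j}. p j \<omega> * p i \<omega>)"
        "expectation (\<lambda>\<omega>. \<Sum>j\<in>?B. \<Sum>i\<in>{i\<in>?B. i < j}. p j \<omega> * p i \<omega>)
          = (\<Sum>j\<in>?B. \<Sum>i\<in>{i\<in>?B. i < j}. q j * q i)"
        using 2 by (auto simp: Bochner_Integration.integral_sum)
      show "integrable M ?L" "expectation ?L = b * P + (\<Sum>j\<in>?B. \<Sum>i\<in>{i\<in>?B. i < j}. q j * q i)"
        using 1 3 by simp_all
    qed
    moreover have R: "integrable M ?R" "expectation ?R = (\<Sum>j\<in>?B. q j * expectation (s j))"
      using ps by (auto simp: Bochner_Integration.integral_sum)
    ultimately have "b * P + (\<Sum>j\<in>?B. q j * (\<Sum>i\<in>{i\<in>?B. i < j}. q i))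
        \<le> (\<Sum>j\<in>?B. q j * expectation (s j))"
      using integral_mono[of M ?L ?R] by (simp add: sum_distrib_left)
    \<comment> \<open>The halves \<open>q j / 2\<close> in the mean busy dates supply the diagonal
      that completes the ordered pairs to \<open>P\<^sup>2 / 2\<close>.\<close>
    moreover have "2 * (\<Sum>j\<in>?B. q j * (\<Sum>i\<in>{i\<in>?B. i < j}. q i)) + (\<Sum>j\<in>?B. (q j)\<^sup>2) = P\<^sup>2"
      unfolding P_def using square_sum_by_order_inj[OF fin inj_on_id2] .
    ultimately have "b * P + P\<^sup>2 / 2
        \<le> (\<Sum>j\<in>?B. q j * expectation (s j)) + (\<Sum>j\<in>?B. (q j)\<^sup>2) / 2"
      by simp
    also have "\<dots> = (\<Sum>j\<in>?B. q j * (expectation (s j) + q j / 2))"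
      by (simp add: sum_divide_distrib sum.distrib[symmetric] power2_eq_square distrib_left)
    also have "\<dots> = expectation (\<lambda>\<omega>. \<Sum>j\<in>?B. q j * (s j \<omega> + p j \<omega> / 2))"
    proof -
      have *: "integrable M (\<lambda>\<omega>. q j * (s j \<omega> + p j \<omega> / 2))"
        "expectation (\<lambda>\<omega>. q j * (s j \<omega> + p j \<omega> / 2)) = q j * (expectation (s j) + q j / 2)"
        if "j \<in> ?B" for j
        using p[OF that] True that by simp_all
      have "expectation (\<lambda>\<omega>. \<Sum>j\<in>?B. q j * (s j \<omega> + p j \<omega> / 2))
          = (\<Sum>j\<in>?B. expectation (\<lambda>\<omega>. q j * (s j \<omega> + p j \<omega> / 2)))"
        using *(1) by (rule Bochner_Integration.integral_sum)
      also have "\<dots> = (\<Sum>j\<in>?B. q j * (expectation (s j) + q j / 2))"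
        using *(2) by (rule sum.cong[OF refl])
      finally show ?thesis ..
    qed
    finally have "ennreal (b * P + P\<^sup>2 / 2)
        \<le> ennreal (expectation (\<lambda>\<omega>. \<Sum>j\<in>?B. q j * (s j \<omega> + p j \<omega> / 2)))"
      by (rule ennreal_leI)
    also have "\<dots> = (\<integral>\<^sup>+\<omega>. ennreal (\<Sum>j\<in>?B. q j * (s j \<omega> + p j \<omega> / 2)) \<partial>M)"
      using True p(1) term_nonneg
      by (intro nn_integral_eq_integral[symmetric] Bochner_Integration.integrable_sum)
        (auto intro!: sum_nonneg)
    finally show ?thesis unfolding m_sum block_mean_busy_date[OF k P_def] .
  next
    case False
    then obtain j where j: "j \<in> ?B" "\<not> integrable M (s j)" by blast
    have "(\<integral>\<^sup>+\<omega>. ennreal (s j \<omega>) \<partial>M) = \<infinity>"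
    proof (rule ccontr)
      assume "(\<integral>\<^sup>+\<omega>. ennreal (s j \<omega>) \<partial>M) \<noteq> \<infinity>"
      then have "integrable M (s j)"
        using s_meas[OF j(1)] s_nonneg[OF j(1)]
        by (intro integrableI_nonneg) (auto simp: less_top)
      then show False using j by simp
    qed
    then have "\<infinity> = (\<integral>\<^sup>+\<omega>. ennreal (q j) * ennreal (s j \<omega>) \<partial>M)"
      using s_meas[OF j(1)] q[OF j(1)] by (simp add: nn_integral_cmult ennreal_mult_top)
    also have "\<dots> \<le> (\<integral>\<^sup>+\<omega>. ennreal (\<Sum>j\<in>?B. q j * (s j \<omega> + p j \<omega> / 2)) \<partial>M)"
    proof (rule nn_integral_mono)
      fix \<omega> assume \<omega>: "\<omega> \<in> space M"
      have "q j * s j \<omega> \<le> q j * (s j \<omega> + p j \<omega> / 2)"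
        using q[OF j(1)] p_nonneg[OF B[OF j(1)] \<omega>] by simp
      also have "\<dots> \<le> (\<Sum>j\<in>?B. q j * (s j \<omega> + p j \<omega> / 2))"
        using term_nonneg[OF _ \<omega>] fin j(1) by (intro member_le_sum) auto
      finally show "ennreal (q j) * ennreal (s j \<omega>)
          \<le> ennreal (\<Sum>j\<in>?B. q j * (s j \<omega> + p j \<omega> / 2))"
        using q[OF j(1)] s_nonneg[OF j(1) \<omega>] by (simp add: ennreal_mult[symmetric] ennreal_leI)
    qed
    finally show ?thesis unfolding m_sum by (simp add: top_unique)
  qed
qed

text \<open>Blocks and prefixes are recombined in \<open>ennreal\<close>, since the cost of the
  policy may be infinite; splitting the sums there rests on every block and prefix sum being
  non-negative.\<close>

lemma WSPT_le_expected_policy: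
  fixes w :: "nat \<Rightarrow> real"
  assumes w: "\<And>j. j \<in> {1..n} \<Longrightarrow> 0 \<le> w j"
    and ratio: "\<And>i j. i \<in> {1..n} \<Longrightarrow> j \<in> {1..n} \<Longrightarrow> i \<le> j \<Longrightarrow> w j / q j \<le> w i / q i"
    and \<pi>: "scheduling_policy n r \<pi>"
  shows "ennreal (\<Sum>j=1..n. w j * preemptive_mean_busy_date q I j)
      \<le> expected_weighted_mean_busy M n w p \<pi>"
proof -
  from weighted_sum_prefix_decomposition[OF w length_pos ratio]
  obtain \<delta> where *: "(\<forall>k\<in>{1..n}. 0 \<le> \<delta> k) \<and>
    (\<forall>a. (\<Sum>j=1..n. w j * a j) = (\<Sum>k=1..n. \<delta> k * (\<Sum>j=1..k. q j * a j)))"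
    by (rule exE)
  note \<delta> = conjunct1[OF *, rule_format] and dec = conjunct2[OF *, rule_format]
  let ?m = "\<lambda>\<omega>. mean_busy_date \<pi> (realisation n p \<omega>)"
  let ?D = "preemptive_mean_busy_date q I"
  have m: "?m \<omega> j = \<pi> (realisation n p \<omega>) j + p j \<omega> / 2" if "j \<in> {1..n}" for j \<omega>
    using that by (simp add: mean_busy_date_def completion_time_def realisation_def)
  have m_meas: "(\<lambda>\<omega>. ?m \<omega> j) \<in> borel_measurable M" if "j \<in> {1..n}" for j
    using policy_start_measurable[OF \<pi> that] p_measurable[OF that] m[OF that] by simp
  have m_nonneg: "0 \<le> q j * ?m \<omega> j" if "j \<in> {1..n}" "\<omega> \<in> space M" for j \<omega>
    using scheduling_policy_release[OF \<pi> realisation_PiE[OF that(2)] that(1)]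
      release_nonneg[OF that(1)] p_nonneg[OF that] length_pos[OF that(1)] m[OF that(1)] by simp
  have D_nonneg: "0 \<le> (\<Sum>j\<in>block k b. q j * ?D j)" if k: "k \<le> n" for k b
  proof (cases "block k b = {}")
    case False
    then have "0 \<le> b" using block_release[OF k] by blast
    moreover have "0 \<le> (\<Sum>j\<in>block k b. q j)"
      using length_pos subsetD[OF block_subset[OF k]]
      by (intro sum_nonneg) (meson less_imp_le)
    ultimately show ?thesis by (simp add: block_mean_busy_date[OF k refl])
  qed simp
  have prefix: "ennreal (\<Sum>j=1..k. q j * ?D j) \<le> (\<integral>\<^sup>+\<omega>. ennreal (\<Sum>j=1..k. q j * ?m \<omega> j) \<partial>M)"
    if k: "k \<in> {1..n}" for k
  proof -
    have k': "k \<le> n" using k by simp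
    have B: "j \<in> {1..n}" if "j \<in> block k b" for j b using block_subset[OF k'] that by blast
    have "ennreal (\<Sum>j=1..k. q j * ?D j)
        = (\<Sum>b\<in>block_start k ` {1..k}. ennreal (\<Sum>j\<in>block k b. q j * ?D j))"
      unfolding sum_blocks using D_nonneg[OF k'] by (intro sum_ennreal[symmetric])
    also have "\<dots> \<le> (\<Sum>b\<in>block_start k ` {1..k}.
        \<integral>\<^sup>+\<omega>. ennreal (\<Sum>j\<in>block k b. q j * ?m \<omega> j) \<partial>M)"
      by (intro sum_mono block_policy_ge[OF k' \<pi>])
    also have "\<dots> = (\<integral>\<^sup>+\<omega>. (\<Sum>b\<in>block_start k ` {1..k}. ennreal (\<Sum>j\<in>block k b. q j * ?m \<omega> j)) \<partial>M)"
      using m_meas[OF B] by (intro nn_integral_sum[symmetric]) auto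
    also have "\<dots> = (\<integral>\<^sup>+\<omega>. ennreal (\<Sum>j=1..k. q j * ?m \<omega> j) \<partial>M)"
      unfolding sum_blocks using m_nonneg[OF B]
      by (intro nn_integral_cong sum_ennreal sum_nonneg) auto
    finally show ?thesis .
  qed
  have "ennreal (\<Sum>j=1..n. w j * ?D j) = (\<Sum>k=1..n. ennreal (\<delta> k) * ennreal (\<Sum>j=1..k. q j * ?D j))"
  proof -
    have D: "0 \<le> (\<Sum>j=1..k. q j * ?D j)" if "k \<in> {1..n}" for k
      unfolding sum_blocks using that by (intro sum_nonneg[OF D_nonneg]) simp
    have "(\<Sum>k=1..n. ennreal (\<delta> k) * ennreal (\<Sum>j=1..k. q j * ?D j))
        = (\<Sum>k=1..n. ennreal (\<delta> k * (\<Sum>j=1..k. q j * ?D j)))"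
      using \<delta> D by (intro sum.cong) (auto simp: ennreal_mult)
    also have "\<dots> = ennreal (\<Sum>j=1..n. w j * ?D j)"
      unfolding dec using \<delta> D by (intro sum_ennreal) auto
    finally show ?thesis ..
  qed
  also have "\<dots> \<le> (\<Sum>k=1..n. ennreal (\<delta> k) * (\<integral>\<^sup>+\<omega>. ennreal (\<Sum>j=1..k. q j * ?m \<omega> j) \<partial>M))"
    using prefix by (intro sum_mono mult_left_mono) auto
  also have "\<dots> = (\<Sum>k=1..n. \<integral>\<^sup>+\<omega>. ennreal (\<delta> k) * ennreal (\<Sum>j=1..k. q j * ?m \<omega> j) \<partial>M)"
    using m_meas by (intro sum.cong nn_integral_cmult[symmetric]) auto
  also have "\<dots> = (\<integral>\<^sup>+\<omega>. (\<Sum>k=1..n. ennreal (\<delta> k) * ennreal (\<Sum>j=1..k. q j * ?m \<omega> j)) \<partial>M)"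
    using m_meas by (intro nn_integral_sum[symmetric]) auto
  also have "\<dots> = expected_weighted_mean_busy M n w p \<pi>"
    unfolding expected_weighted_mean_busy_def
  proof (rule nn_integral_cong)
    fix \<omega> assume \<omega>: "\<omega> \<in> space M"
    have D: "0 \<le> (\<Sum>j=1..k. q j * ?m \<omega> j)" if "k \<in> {1..n}" for k
      using m_nonneg[OF _ \<omega>] that by (intro sum_nonneg) auto
    have "(\<Sum>k=1..n. ennreal (\<delta> k) * ennreal (\<Sum>j=1..k. q j * ?m \<omega> j))
        = (\<Sum>k=1..n. ennreal (\<delta> k * (\<Sum>j=1..k. q j * ?m \<omega> j)))"
      using \<delta> D by (intro sum.cong) (auto simp: ennreal_mult)
    also have "\<dots> = ennreal (\<Sum>j=1..n. w j * ?m \<omega> j)"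
      unfolding dec using \<delta> D by (intro sum_ennreal) auto
    finally show "(\<Sum>k=1..n. ennreal (\<delta> k) * ennreal (\<Sum>j=1..k. q j * ?m \<omega> j))
        = ennreal (\<Sum>j=1..n. w j * ?m \<omega> j)" .
  qed
  finally show ?thesis .
qed

end

section \<open>Comparison of SOS, the preemptive schedule and the optimum\<close>

theorem theorem3:
  fixes M :: "'a measure" and n :: nat and w r :: "nat \<Rightarrow> real"
    and p :: "nat \<Rightarrow> 'a \<Rightarrow> real" and \<Delta> \<alpha> c :: real
    and pbar :: "nat \<Rightarrow> real" and I :: "nat \<Rightarrow> real \<Rightarrow> real"
  defines "pbar \<equiv> \<lambda>j. prob_space.expectation M (p j)"
    and "c \<equiv> 1 + max (1 / \<alpha>) (1 + \<alpha> - g \<Delta> * (1 - \<alpha>))"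
  assumes "prob_space M"
    and "\<And>j. j \<in> {1..n} \<Longrightarrow> w j \<ge> 0"
    and "\<And>j. j \<in> {1..n} \<Longrightarrow> r j \<ge> 0"
    and "prob_space.indep_vars M (\<lambda>_. borel) p {1..n}"
    and "\<And>j \<omega>. j \<in> {1..n} \<Longrightarrow> \<omega> \<in> space M \<Longrightarrow> p j \<omega> \<ge> 0"
    and "\<And>j. j \<in> {1..n} \<Longrightarrow> integrable M (p j)"
    and "\<And>j. j \<in> {1..n} \<Longrightarrow> pbar j > 0"
    and "\<And>j. j \<in> {1..n} \<Longrightarrow> integrable M (\<lambda>\<omega>. (p j \<omega>)\<^sup>2)"
    and "\<And>j. j \<in> {1..n} \<Longrightarrow> CV2 M (p j) \<le> \<Delta>"
    and "\<And>i j. i \<in> {1..n} \<Longrightarrow> j \<in> {1..n} \<Longrightarrow> i \<le> j \<Longrightarrow> w i / pbar i \<ge> w j / pbar j"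
    and "0 < \<alpha>" and "\<alpha> \<le> 1"
    and "preemptive_WSPT n r pbar I"
  shows "expected_weighted_mean_busy M n w p (SOS n pbar I \<alpha>)
           \<le> ennreal (c * (\<Sum>j=1..n. w j * preemptive_mean_busy_date pbar I j)) \<and>
         (\<forall>OPT. optimal_policy M n w r p OPT \<longrightarrow>
            ennreal (c * (\<Sum>j=1..n. w j * preemptive_mean_busy_date pbar I j))
              \<le> ennreal c * expected_weighted_mean_busy M n w p OPT)"
proof -
  interpret prob_space M by fact
  have sched: "WSPT_schedule n r pbar I"
    using assms(5,9,15) by unfold_locales auto
  interpret stochastic_WSPT_schedule M n r pbar I p \<Delta>
    using assms(6-8,10,11)
    by (intro stochastic_WSPT_schedule.intro sched prob_space_axioms
        stochastic_WSPT_schedule_axioms.intro) (auto simp: pbar_def)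
  \<comment> \<open>The maximum is at least \<open>1 / \<alpha>\<close>, so \<open>c\<close> is
    non-negative and can be pulled out of \<open>ennreal\<close>.\<close>
  have "0 \<le> c" using \<open>0 < \<alpha>\<close> by (auto simp: c_def intro!: add_nonneg_nonneg max.coboundedI1)
  moreover have "ennreal (\<Sum>j=1..n. w j * preemptive_mean_busy_date pbar I j)
      \<le> expected_weighted_mean_busy M n w p OPT" if "optimal_policy M n w r p OPT" for OPT
    using that by (intro WSPT_le_expected_policy assms(4,12)) (auto simp: optimal_policy_def)
  ultimately show ?thesis
    using expected_SOS_le[OF assms(13,14,4,12)]
    by (auto simp: c_def[symmetric] ennreal_mult' intro!: mult_left_mono)
qed

end
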